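(* Let $\triangle\subset\mathbb{R}^2$ be an open equilateral triangle of side $L>0$. Then the function $$p_t^{\triangle}(x,y)=\sum_{l=0}^{\infty}(-1)^{s(l)}\,p_{0,t}(x,R_l y),\qquad x,y\in\triangle,\ t>0,$$ is the (Dirichlet) heat kernel of the equilateral triangle $\triangle$.
   Context: $p_{0,t}(x,y)=\frac{1}{4\pi t}e^{-\|x-y\|^2/(4t)}$ is the Gauss–Weierstrass kernel on $\mathbb{R}^2$. Successive reflections of $\triangle$ in its three side lines generate a tessellation of the plane by congruent triangles (virtual domains), enumerated by $l=0,1,2,\dots$ with $l=0$ corresponding to $\triangle$ itself. $R_l$ is the composition of reflections mapping $\triangle$ to the region $l$, with $R_0=\mathrm{id}$; thus $\{R_l\}_{l\ge0}$ enumerates the (affine reflection) group generated by the three reflections in the side lines of $\triangle$. The length $s(l)$ is the minimum number of these reflections needed to write $R_l$. The heat kernel of a bounded open set $\Omega$ is the integral kernel of the heat semigroup $e^{t\Delta_D}$ on $L^2(\Omega)$, where $\Delta_D$ is the Dirichlet Laplacian; equivalently, it is the minimal positive fundamental solution of the heat equation $\partial_t u=\Delta u$ on $\Omega$. *)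

theory Defs
  imports "HOL-Analysis.Analysis"
begin

definition gauss_kernel :: "real \<Rightarrow> real^2 \<Rightarrow> real^2 \<Rightarrow> real" where
  "gauss_kernel t x y = 1 / (4 * pi * t) * exp (- (norm (x - y))\<^sup>2 / (4 * t))"

text \<open>
  Classical solutions of class C(1,2) on (0,\<infinity>) \<times> \<Omega>: the function, its time derivative, spatial
  gradient \<open>G\<close> and spatial Hessian \<open>H\<close> are jointly continuous. The trace of the Hessian is the
  Laplacian. Values of \<open>u\<close> outside (0,\<infinity>) \<times> \<Omega> are irrelevant.
\<close>

definition heat_solution :: "(real^'n) set \<Rightarrow> (real \<Rightarrow> real^'n \<Rightarrow> real) \<Rightarrow> bool" where
  "heat_solution \<Omega> u \<longleftrightarrow>
    (\<exists>(ut :: real \<Rightarrow> real^'n \<Rightarrow> real) (G :: real \<Rightarrow> real^'n \<Rightarrow> real^'n)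
       (H :: real \<Rightarrow> real^'n \<Rightarrow> real^'n^'n).
      continuous_on ({0<..} \<times> \<Omega>) (\<lambda>(t, x). u t x) \<and>
      continuous_on ({0<..} \<times> \<Omega>) (\<lambda>(t, x). ut t x) \<and>
      continuous_on ({0<..} \<times> \<Omega>) (\<lambda>(t, x). G t x) \<and>
      continuous_on ({0<..} \<times> \<Omega>) (\<lambda>(t, x). H t x) \<and>
      (\<forall>t>0. \<forall>x\<in>\<Omega>.
        ((\<lambda>s. u s x) has_real_derivative ut t x) (at t) \<and>
        (u t has_derivative (\<lambda>h. G t x \<bullet> h)) (at x) \<and>
        (G t has_derivative (\<lambda>h. H t x *v h)) (at x) \<and>
        ut t x = trace (H t x)))"

text \<open>
  The initial condition says that the measures \<open>u(t,x) dx\<close> on \<Omega> converge vaguely to the Dirac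
  measure at \<open>y\<close>. For nonnegative \<open>u\<close>, testing with continuous or with smooth compactly supported
  functions amounts to the same. \<open>Positive\<close> is meant in the weak sense: the heat kernel of a
  disconnected set vanishes for \<open>x\<close>, \<open>y\<close> in different components.
\<close>

definition positive_fundamental_solution ::
    "(real^'n) set \<Rightarrow> real^'n \<Rightarrow> (real \<Rightarrow> real^'n \<Rightarrow> real) \<Rightarrow> bool" where
  "positive_fundamental_solution \<Omega> y u \<longleftrightarrow>
    heat_solution \<Omega> u \<and>
    (\<forall>t>0. \<forall>x\<in>\<Omega>. 0 \<le> u t x) \<and>
    (\<forall>\<phi> :: real^'n \<Rightarrow> real. \<forall>K.
      continuous_on UNIV \<phi> \<and> compact K \<and> K \<subseteq> \<Omega> \<and> (\<forall>x. x \<notin> K \<longrightarrow> \<phi> x = 0) \<longrightarrow>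
      ((\<lambda>t. LINT x:\<Omega>|lborel. u t x * \<phi> x) \<longlongrightarrow> \<phi> y) (at_right 0))"

text \<open>
  The (Dirichlet) heat kernel as the minimal positive fundamental solution of
  \<open>\<partial>\<^sub>t u = \<Delta> u\<close> on \<Omega>. No boundary condition appears, because minimality encodes it.
\<close>

definition is_heat_kernel ::
    "(real^'n) set \<Rightarrow> (real \<Rightarrow> real^'n \<Rightarrow> real^'n \<Rightarrow> real) \<Rightarrow> bool" where
  "is_heat_kernel \<Omega> p \<longleftrightarrow>
    (\<forall>y\<in>\<Omega>. positive_fundamental_solution \<Omega> y (\<lambda>t x. p t x y) \<and>
      (\<forall>q. positive_fundamental_solution \<Omega> y q \<longrightarrow> (\<forall>t>0. \<forall>x\<in>\<Omega>. p t x y \<le> q t x)))"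

definition reflection :: "(real^2) set \<Rightarrow> real^2 \<Rightarrow> real^2" where
  "reflection S x = 2 *\<^sub>R closest_point S x - x"

definition side_reflections :: "real^2 \<Rightarrow> real^2 \<Rightarrow> real^2 \<Rightarrow> (real^2 \<Rightarrow> real^2) set" where
  "side_reflections A B C =
    {reflection (affine hull {A, B}), reflection (affine hull {B, C}),
     reflection (affine hull {C, A})}"

definition compose_word :: "('a \<Rightarrow> 'a) list \<Rightarrow> 'a \<Rightarrow> 'a" where
  "compose_word w = foldr (\<circ>) w id"

text \<open>Words without formal inverses suffice for the group, as reflections are involutions.\<close>

definition reflection_group :: "real^2 \<Rightarrow> real^2 \<Rightarrow> real^2 \<Rightarrow> (real^2 \<Rightarrow> real^2) set" where
  "reflection_group A B C = compose_word ` lists (side_reflections A B C)"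

definition reflection_length ::
    "real^2 \<Rightarrow> real^2 \<Rightarrow> real^2 \<Rightarrow> (real^2 \<Rightarrow> real^2) \<Rightarrow> nat" where
  "reflection_length A B C g =
    (LEAST n. \<exists>w \<in> lists (side_reflections A B C). length w = n \<and> compose_word w = g)"

end

theory Submission
  imports Defs "HOL-Probability.Probability" "HOL-Real_Asymp.Real_Asymp"
begin

text \<open>
  Method of images. The linear part of every group element is a permutation of suitable coordinates
  whose sign is the parity of its word length; hence the alternating sum changes sign under each side
  reflection and vanishes on the boundary. The triangle is a fundamental domain, so for
  \<open>t \<rightarrow> 0\<close> only the term \<open>l = 0\<close> survives, uniformly on \<open>\<Delta>\<close>. The maximum principle then
  gives positivity. For minimality, let \<open>q\<close> be a positive fundamental solution with pole \<open>y\<close>,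
  restart it at time \<open>\<epsilon>\<close> and cut off its values there by a function \<open>\<phi>\<close> with compact support and
  \<open>\<phi> y = 1\<close>: the maximum principle gives
  \<open>\<integral> p t x z * q \<epsilon> z * \<phi> z dz \<le> q (\<epsilon> + t) x\<close>, and \<open>\<epsilon> \<rightarrow> 0\<close> yields \<open>p t x y \<le> q t x\<close>.
\<close>

section \<open>The Gauss kernel as an approximate identity\<close>

text \<open>The obstacle is that a competitor \<open>q\<close> has no known boundary values and
  meets its initial condition only vaguely. The comparison principle is therefore lopsided: the
  upper function is merely nonnegative inside the domain, while the lower one is continuous up to
  the boundary, nonpositive there, and uniformly below the upper one as t tends to 0. The pole
  blocks this last condition, so it is not the kernel that is compared with \<open>q\<close> but its
  integrals against continuous data of compact support. They run over the second argument of the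
  kernel, hence solve the heat equation in the first. Geometry enters only through the locale
  \<open>image_system\<close>: isometries carrying the domain to disjoint images, and a
  sign-reversing symmetry of the images at each boundary point. For the triangle both rest on one
  rigidity fact about the affine symmetric group: an element taking some point of the open triangle
  to another one is the identity. This gives disjointness, and it makes the permutation attached to
  a group element unique, so that its sign is well defined.\<close>

lemma gauss_kernel_commute: "gauss_kernel t x y = gauss_kernel t y x"
  by (simp add: gauss_kernel_def norm_minus_commute)

lemma gauss_kernel_diff: "gauss_kernel t x y = gauss_kernel t (x - y) 0"
  by (simp add: gauss_kernel_def)

lemma gauss_kernel_nonneg: "0 \<le> t \<Longrightarrow> 0 \<le> gauss_kernel t x y"
  by (simp add: gauss_kernel_def)

text \<open>For the equation without the factor 1/2 the kernel is a product of two normal densities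
  of variance 2 * t, one per coordinate, so its mass is a product of two total
  probabilities.\<close>

lemma has_bochner_integral_gauss_kernel:
  assumes "t > 0"
  shows "has_bochner_integral lborel (\<lambda>x. gauss_kernel t x y) 1"
proof (rule has_bochner_integral_nn_integral)
  define g where "g b u = ennreal (normal_density (y \<bullet> b) (sqrt (2 * t)) u)" for b :: "real^2" and u
  have eq: "ennreal (gauss_kernel t x y) = (\<Prod>b\<in>Basis. g b (x \<bullet> b))" for x
  proof -
    have "(\<Prod>b\<in>Basis. g b (x \<bullet> b)) =
        ennreal (\<Prod>b\<in>Basis. normal_density (y \<bullet> b) (sqrt (2 * t)) (x \<bullet> b))"
      unfolding g_def by (rule prod_ennreal) simp
    also have "(\<Prod>b\<in>Basis. normal_density (y \<bullet> b) (sqrt (2 * t)) (x \<bullet> b)) =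
        (\<Prod>b\<in>Basis. (1 / sqrt (4 * pi * t)) * exp (- ((x - y) \<bullet> b)\<^sup>2 / (4 * t)))"
      using assms by (simp add: normal_density_def inner_diff_left mult.assoc)
    also have "\<dots> = (1 / sqrt (4 * pi * t)) ^ 2 *
        exp (\<Sum>b\<in>Basis. - ((x - y) \<bullet> b)\<^sup>2 / (4 * t))"
      by (simp only: prod.distrib exp_sum[OF finite_Basis] prod_constant) simp
    also have "(1 / sqrt (4 * pi * t)) ^ 2 = 1 / (4 * pi * t)"
      using assms by (simp add: power_divide)
    also have "(\<Sum>b\<in>Basis. - ((x - y) \<bullet> b)\<^sup>2 / (4 * t)) = - (norm (x - y))\<^sup>2 / (4 * t)"
    proof -
      have "(norm (x - y))\<^sup>2 = (\<Sum>b\<in>Basis. ((x - y) \<bullet> b)\<^sup>2)"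
        unfolding power2_norm_eq_inner power2_eq_square[of "_ \<bullet> _"] by (rule euclidean_inner)
      then show ?thesis by (simp add: sum_divide_distrib sum_negf)
    qed
    finally show ?thesis by (simp add: gauss_kernel_def)
  qed
  have one: "(\<integral>\<^sup>+u. g b u \<partial>lborel) = 1" for b
  proof -
    have "0 < sqrt (2 * t)" using assms by simp
    then have "prob_space (density lborel (normal_density (y \<bullet> b) (sqrt (2 * t))))"
      by (rule prob_space_normal_density)
    from prob_space.emeasure_space_1[OF this] show ?thesis
      by (simp add: g_def emeasure_density)
  qed
  have "(\<integral>\<^sup>+x. ennreal (gauss_kernel t x y) \<partial>lborel) = (\<Prod>b\<in>(Basis::(real^2) set). \<integral>\<^sup>+u. g b u \<partial>lborel)"
    unfolding eq by (rule nn_integral_lborel_prod) (simp_all add: g_def)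
  also have "\<dots> = 1" by (simp add: one)
  finally show "(\<integral>\<^sup>+x. ennreal (gauss_kernel t x y) \<partial>lborel) = ennreal 1" by simp
  show "(\<lambda>x. gauss_kernel t x y) \<in> borel_measurable lborel"
    unfolding gauss_kernel_def by measurable
qed (use assms in \<open>auto simp: gauss_kernel_nonneg\<close>)

lemma
  assumes "t > 0"
  shows integrable_gauss_kernel: "integrable lborel (\<lambda>x. gauss_kernel t x y)"
    and integral_gauss_kernel: "(LINT x|lborel. gauss_kernel t x y) = 1"
  using has_bochner_integral_gauss_kernel[OF assms] by (simp_all add: has_bochner_integral_iff)

text \<open>With r = |x - y|^2 / (8 t) the exponent is -2 r. One factor exp(-r) absorbs r, since r *
  exp(-r) \<le> 1; the other is a Gauss kernel at time 2 * t, whose integral is again 1.\<close>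

lemma gauss_kernel_second_moment:
  assumes "t > 0"
  shows "(norm (x - y))\<^sup>2 * gauss_kernel t x y \<le> 16 * t * gauss_kernel (2 * t) x y"
proof -
  define r where "r = (norm (x - y))\<^sup>2 / (8 * t)"
  have "r \<le> exp r"
    using exp_ge_add_one_self[of r] by linarith
  then have "r * exp (- r) \<le> 1"
    by (simp add: exp_minus divide_simps)
  then have "r * exp (- r) * exp (- r) \<le> exp (- r)"
    by (intro mult_left_le_one_le) (simp_all add: r_def mult_nonneg_nonneg assms less_imp_le)
  then have "r * exp (- r) * exp (- r) * (8 * t / (4 * pi * t)) \<le> exp (- r) * (8 * t / (4 * pi * t))"
    using assms by (intro mult_right_mono) auto
  moreover have "exp (- (norm (x - y))\<^sup>2 / (4 * t)) = exp (- r) * exp (- r)"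
    by (simp add: r_def exp_add[symmetric])
  then have "(norm (x - y))\<^sup>2 * gauss_kernel t x y =
      r * exp (- r) * exp (- r) * (8 * t / (4 * pi * t))"
    using assms by (simp add: gauss_kernel_def r_def)
  moreover have "exp (- (norm (x - y))\<^sup>2 / (4 * (2 * t))) = exp (- r)"
    by (simp add: r_def)
  then have "16 * t * gauss_kernel (2 * t) x y = exp (- r) * (8 * t / (4 * pi * t))"
    using assms by (simp add: gauss_kernel_def)
  ultimately show ?thesis by linarith
qed

section \<open>Continuous functions of compact support and the short-time limit\<close>

lemma bounded_compact_support:
  fixes f :: "'a::euclidean_space \<Rightarrow> real"
  assumes "continuous_on UNIV f" "compact K" "\<And>x. x \<notin> K \<Longrightarrow> f x = 0"
  obtains M where "M > 0" "\<And>x. \<bar>f x\<bar> \<le> M"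
proof -
  have "bounded (f ` K)"
    using assms by (intro compact_imp_bounded compact_continuous_image)
      (auto intro: continuous_on_subset)
  then obtain M where "M > 0" and M: "\<forall>y\<in>f ` K. norm y \<le> M" unfolding bounded_pos by blast
  have "\<bar>f x\<bar> \<le> M" for x using M \<open>M > 0\<close> assms(3)[of x] by (cases "x \<in> K") auto
  with \<open>M > 0\<close> that show ?thesis by blast
qed

text \<open>Uniform continuity on a ball one unit larger than a ball containing \<open>K\<close>
  suffices: if two points are less than 1 apart and one of them leaves the larger ball, both lie
  outside \<open>K\<close>.\<close>

lemma uniformly_continuous_compact_support:
  fixes f :: "'a::euclidean_space \<Rightarrow> real"
  assumes "continuous_on UNIV f" "compact K" "\<And>x. x \<notin> K \<Longrightarrow> f x = 0"
  shows "uniformly_continuous_on UNIV f"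
  unfolding uniformly_continuous_on_def
proof (intro allI impI)
  fix e :: real assume "e > 0"
  obtain r where "\<forall>x\<in>K. norm x \<le> r"
    using compact_imp_bounded[OF assms(2)] unfolding bounded_iff by blast
  then have r: "K \<subseteq> cball 0 r" by auto
  have "uniformly_continuous_on (cball 0 (r + 1)) f"
    by (intro compact_uniformly_continuous) (auto intro: continuous_on_subset[OF assms(1)])
  then obtain d where "d > 0" and
    d: "\<And>x x'. x \<in> cball 0 (r + 1) \<Longrightarrow> x' \<in> cball 0 (r + 1) \<Longrightarrow> dist x' x < d \<Longrightarrow> dist (f x') (f x) < e"
    unfolding uniformly_continuous_on_def using \<open>e > 0\<close> by meson
  show "\<exists>d>0. \<forall>x\<in>UNIV. \<forall>x'\<in>UNIV. dist x' x < d \<longrightarrow> dist (f x') (f x) < e"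
  proof (intro exI[of _ "min d 1"] conjI ballI impI)
    show "min d 1 > 0" using \<open>d > 0\<close> by simp
    fix x x' :: 'a assume lt: "dist x' x < min d 1"
    show "dist (f x') (f x) < e"
    proof (cases "x \<in> cball 0 (r + 1) \<and> x' \<in> cball 0 (r + 1)")
      case True with d lt show ?thesis by simp
    next
      case False
      have "norm x \<le> norm x' + dist x' x" "norm x' \<le> norm x + dist x' x"
        using norm_triangle_ineq2[of x x'] norm_triangle_ineq2[of x' x]
        by (auto simp: dist_norm norm_minus_commute)
      with False lt have "x \<notin> cball 0 r" "x' \<notin> cball 0 r" by auto
      with r assms(3) \<open>e > 0\<close> show ?thesis by (metis dist_self subsetD)
    qed
  qed
qed

lemma integrable_gauss_kernel_mult:
  assumes "t > 0" "continuous_on UNIV f" "\<And>z. \<bar>f z\<bar> \<le> M"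
  shows "integrable lborel (\<lambda>z. gauss_kernel t x z * f z)"
proof (rule Bochner_Integration.integrable_bound)
  show "integrable lborel (\<lambda>z. M * gauss_kernel t z x)"
    using integrable_gauss_kernel[OF assms(1)] by simp
  show "(\<lambda>z. gauss_kernel t x z * f z) \<in> borel_measurable lborel"
    using borel_measurable_continuous_onI[OF assms(2)] unfolding gauss_kernel_def by simp
  show "AE z in lborel. norm (gauss_kernel t x z * f z) \<le> norm (M * gauss_kernel t z x)"
  proof (intro AE_I2)
    fix z
    have "\<bar>f z\<bar> \<le> \<bar>M\<bar>" using assms(3)[of z] by linarith
    then show "norm (gauss_kernel t x z * f z) \<le> norm (M * gauss_kernel t z x)"
      by (simp add: abs_mult gauss_kernel_commute[of t x] mult.commute mult_right_mono)
  qed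
qed

text \<open>Uniformity in \<open>x\<close>, inherited from the uniform continuity of
  \<open>f\<close>, is what the initial hypothesis of the maximum principle demands.\<close>

lemma gauss_kernel_approximate_identity:
  fixes f :: "real^2 \<Rightarrow> real"
  assumes "continuous_on UNIV f" "compact K" "\<And>x. x \<notin> K \<Longrightarrow> f x = 0" "\<delta> > 0"
  shows "\<forall>\<^sub>F t in at_right 0. \<forall>x. \<bar>(LINT z|lborel. gauss_kernel t x z * f z) - f x\<bar> \<le> \<delta>"
proof -
  obtain M where "M > 0" and M: "\<And>x. \<bar>f x\<bar> \<le> M"
    using bounded_compact_support[OF assms(1-3)] by blast
  obtain \<eta> where "\<eta> > 0" and \<eta>: "\<And>x z. dist z x < \<eta> \<Longrightarrow> \<bar>f z - f x\<bar> < \<delta> / 2"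
    using uniformly_continuous_compact_support[OF assms(1-3)] assms(4)
    unfolding uniformly_continuous_on_def dist_real_def by (metis UNIV_I half_gt_zero)
  \<comment> \<open>Trading the far part for a quadratic term reduces the claim to a second moment.\<close>
  have le: "\<bar>f z - f x\<bar> \<le> \<delta> / 2 + 2 * M / \<eta>\<^sup>2 * (norm (z - x))\<^sup>2" for x z
  proof (cases "dist z x < \<eta>")
    case True
    have "0 \<le> 2 * M / \<eta>\<^sup>2 * (norm (z - x))\<^sup>2" using \<open>M > 0\<close> by simp
    with \<eta>[OF True] show ?thesis by linarith
  next
    case False
    then have "\<eta>\<^sup>2 \<le> (norm (z - x))\<^sup>2"
      using \<open>\<eta> > 0\<close> by (intro power_mono) (auto simp: dist_norm)
    then have "2 * M * 1 \<le> 2 * M * ((norm (z - x))\<^sup>2 / \<eta>\<^sup>2)"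
      using \<open>M > 0\<close> \<open>\<eta> > 0\<close> by (intro mult_left_mono) simp_all
    then show ?thesis using M[of x] M[of z] assms(4) by simp
  qed
  have bound: "\<bar>(LINT z|lborel. gauss_kernel t x z * f z) - f x\<bar> \<le> \<delta> / 2 + 32 * M / \<eta>\<^sup>2 * t"
    if "t > 0" for t x
  proof -
    have "0 < 2 * t" using that by simp
    note I = integrable_gauss_kernel[OF \<open>0 < t\<close>, of x] integrable_gauss_kernel[OF \<open>0 < 2 * t\<close>, of x]
    have i1: "integrable lborel (\<lambda>z. gauss_kernel t x z * f z)"
      by (rule integrable_gauss_kernel_mult[OF that assms(1) M])
    have i2: "integrable lborel (\<lambda>z. gauss_kernel t x z * f x)"
      using I(1) by (simp add: gauss_kernel_commute[of t x])
    have "(LINT z|lborel. gauss_kernel t x z * f z) - f x =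
        (LINT z|lborel. gauss_kernel t x z * f z) - (LINT z|lborel. gauss_kernel t x z * f x)"
      using integral_gauss_kernel[OF that, of x] by (simp add: gauss_kernel_commute[of t x])
    also have "\<dots> = (LINT z|lborel. gauss_kernel t x z * (f z - f x))"
      using i1 i2 by (simp add: right_diff_distrib)
    finally have "\<bar>(LINT z|lborel. gauss_kernel t x z * f z) - f x\<bar> \<le>
        (LINT z|lborel. \<bar>gauss_kernel t x z * (f z - f x)\<bar>)"
      by simp
    also have "\<dots> \<le> (LINT z|lborel. \<delta> / 2 * gauss_kernel t z x +
        32 * M / \<eta>\<^sup>2 * t * gauss_kernel (2 * t) z x)"
    proof (rule integral_mono)
      show "integrable lborel (\<lambda>z. \<bar>gauss_kernel t x z * (f z - f x)\<bar>)"
        using i1 i2 by (simp add: right_diff_distrib)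
      show "integrable lborel (\<lambda>z. \<delta> / 2 * gauss_kernel t z x +
          32 * M / \<eta>\<^sup>2 * t * gauss_kernel (2 * t) z x)"
        using I by simp
      fix z
      have "\<bar>gauss_kernel t x z * (f z - f x)\<bar> = gauss_kernel t z x * \<bar>f z - f x\<bar>"
        using gauss_kernel_nonneg[of t z x] that
        by (simp add: abs_mult gauss_kernel_commute[of t x])
      also have "\<dots> \<le> gauss_kernel t z x * (\<delta> / 2 + 2 * M / \<eta>\<^sup>2 * (norm (z - x))\<^sup>2)"
        using gauss_kernel_nonneg[of t z x] that by (intro mult_left_mono le) auto
      also have "\<dots> = \<delta> / 2 * gauss_kernel t z x +
          2 * M / \<eta>\<^sup>2 * ((norm (z - x))\<^sup>2 * gauss_kernel t z x)"
        by (simp add: algebra_simps)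
      also have "\<dots> \<le> \<delta> / 2 * gauss_kernel t z x +
          2 * M / \<eta>\<^sup>2 * (16 * t * gauss_kernel (2 * t) z x)"
        using \<open>M > 0\<close> gauss_kernel_second_moment[OF that, of z x]
        by (intro add_left_mono mult_left_mono) auto
      finally show "\<bar>gauss_kernel t x z * (f z - f x)\<bar> \<le>
          \<delta> / 2 * gauss_kernel t z x + 32 * M / \<eta>\<^sup>2 * t * gauss_kernel (2 * t) z x"
        by (simp add: mult.assoc)
    qed
    also have "\<dots> = \<delta> / 2 + 32 * M / \<eta>\<^sup>2 * t"
      using I integral_gauss_kernel[OF that, of x] integral_gauss_kernel[OF \<open>0 < 2 * t\<close>, of x]
      by simp
    finally show ?thesis .
  qed
  have "((\<lambda>t. \<delta> / 2 + 32 * M / \<eta>\<^sup>2 * t) \<longlongrightarrow> \<delta> / 2 + 32 * M / \<eta>\<^sup>2 * 0) (at_right 0)"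
    by (intro tendsto_intros)
  then have "\<forall>\<^sub>F t in at_right 0. \<delta> / 2 + 32 * M / \<eta>\<^sup>2 * t < \<delta>"
    by (rule order_tendstoD) (use assms(4) in simp)
  then show ?thesis
    using eventually_at_right_less[of "0::real"]
    by eventually_elim (use bound order.trans less_imp_le in blast)
qed

section \<open>The parabolic maximum principle\<close>

text \<open>
  Solutions in a weaker sense than \<^const>\<open>heat_solution\<close>: only derivatives along the coordinate
  axes are required, which is all that the maximum principle uses.
\<close>

definition axiswise_caloric :: "(real^'n) set \<Rightarrow> (real \<Rightarrow> real^'n \<Rightarrow> real) \<Rightarrow> bool" where
  "axiswise_caloric \<Omega> u \<longleftrightarrow>
    (\<exists>(ut :: real \<Rightarrow> real^'n \<Rightarrow> real) (u1 :: 'n \<Rightarrow> real \<Rightarrow> real^'n \<Rightarrow> real)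
       (u2 :: 'n \<Rightarrow> real \<Rightarrow> real^'n \<Rightarrow> real). \<forall>t>0. \<forall>x\<in>\<Omega>.
        ((\<lambda>s. u s x) has_real_derivative ut t x) (at t) \<and>
        (\<forall>i. ((\<lambda>h. u t (x + h *\<^sub>R axis i 1)) has_real_derivative u1 i t x) (at 0) \<and>
             ((\<lambda>h. u1 i t (x + h *\<^sub>R axis i 1)) has_real_derivative u2 i t x) (at 0)) \<and>
        ut t x = (\<Sum>i\<in>UNIV. u2 i t x))"

lemma axiswise_caloric_diff:
  fixes u v :: "real \<Rightarrow> real^'n \<Rightarrow> real"
  assumes "axiswise_caloric \<Omega> u" "axiswise_caloric \<Omega> v"
  shows "axiswise_caloric \<Omega> (\<lambda>t x. u t x - v t x)"
proof -
  obtain ut u1 u2 vt v1 v2 where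
    u: "\<forall>t>0. \<forall>x\<in>\<Omega>. ((\<lambda>s. u s x) has_real_derivative ut t x) (at t) \<and>
        (\<forall>i. ((\<lambda>h. u t (x + h *\<^sub>R axis i 1)) has_real_derivative u1 i t x) (at 0) \<and>
             ((\<lambda>h. u1 i t (x + h *\<^sub>R axis i 1)) has_real_derivative u2 i t x) (at 0)) \<and>
        ut t x = (\<Sum>i\<in>UNIV. u2 i t x)" and
    v: "\<forall>t>0. \<forall>x\<in>\<Omega>. ((\<lambda>s. v s x) has_real_derivative vt t x) (at t) \<and>
        (\<forall>i. ((\<lambda>h. v t (x + h *\<^sub>R axis i 1)) has_real_derivative v1 i t x) (at 0) \<and>
             ((\<lambda>h. v1 i t (x + h *\<^sub>R axis i 1)) has_real_derivative v2 i t x) (at 0)) \<and>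
        vt t x = (\<Sum>i\<in>UNIV. v2 i t x)"
    using assms unfolding axiswise_caloric_def by blast
  show ?thesis
    unfolding axiswise_caloric_def
  proof (rule exI[of _ "\<lambda>t x. ut t x - vt t x"], rule exI[of _ "\<lambda>i t x. u1 i t x - v1 i t x"], rule exI[of _ "\<lambda>i t x. u2 i t x - v2 i t x"],
      intro allI impI ballI conjI)
    fix t :: real and x :: "real^'n" and i :: 'n assume "t > 0" "x \<in> \<Omega>"
    note u' = u[rule_format, OF this] and v' = v[rule_format, OF this]
    show "((\<lambda>s. u s x - v s x) has_real_derivative ut t x - vt t x) (at t)"
      using u' v' by (intro DERIV_diff) blast+
    show "ut t x - vt t x = (\<Sum>i\<in>UNIV. u2 i t x - v2 i t x)"
      using u' v' by (simp add: sum_subtractf)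
    show "((\<lambda>h. u t (x + h *\<^sub>R axis i 1) - v t (x + h *\<^sub>R axis i 1)) has_real_derivative
        u1 i t x - v1 i t x) (at 0)"
      using u' v' by (intro DERIV_diff) blast+
    show "((\<lambda>h. u1 i t (x + h *\<^sub>R axis i 1) - v1 i t (x + h *\<^sub>R axis i 1)) has_real_derivative
        u2 i t x - v2 i t x) (at 0)"
      using u' v' by (intro DERIV_diff) blast+
  qed
qed

lemma axiswise_caloric_const: "axiswise_caloric \<Omega> (\<lambda>t x. c)"
  unfolding axiswise_caloric_def
  by (rule exI[of _ "\<lambda>_ _. 0"], rule exI[of _ "\<lambda>_ _ _. 0"], rule exI[of _ "\<lambda>_ _ _. 0"]) simp

lemma axiswise_caloric_shift:
  assumes "axiswise_caloric \<Omega> u" "e \<ge> 0"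
  shows "axiswise_caloric \<Omega> (\<lambda>t. u (e + t))"
proof -
  obtain ut u1 u2 where
    u: "\<forall>t>0. \<forall>x\<in>\<Omega>. ((\<lambda>s. u s x) has_real_derivative ut t x) (at t) \<and>
        (\<forall>i. ((\<lambda>h. u t (x + h *\<^sub>R axis i 1)) has_real_derivative u1 i t x) (at 0) \<and>
             ((\<lambda>h. u1 i t (x + h *\<^sub>R axis i 1)) has_real_derivative u2 i t x) (at 0)) \<and>
        ut t x = (\<Sum>i\<in>UNIV. u2 i t x)"
    using assms unfolding axiswise_caloric_def by blast
  show ?thesis
    unfolding axiswise_caloric_def
  proof (rule exI[of _ "\<lambda>t. ut (e + t)"], rule exI[of _ "\<lambda>i t. u1 i (e + t)"], rule exI[of _ "\<lambda>i t. u2 i (e + t)"],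
      intro allI impI ballI)
    fix t :: real and x assume "t > 0" "x \<in> \<Omega>"
    then have "e + t > 0" using assms(2) by simp
    note u' = u[rule_format, OF this \<open>x \<in> \<Omega>\<close>]
    from conjunct1[OF this] have "((\<lambda>s. u (e + s) x) has_real_derivative ut (e + t) x) (at t)"
      using DERIV_shift[of "\<lambda>s. u s x" _ t e] by (simp only: add.commute[of e])
    with u' show "((\<lambda>s. u (e + s) x) has_real_derivative ut (e + t) x) (at t) \<and>
        (\<forall>i. ((\<lambda>h. u (e + t) (x + h *\<^sub>R axis i 1)) has_real_derivative u1 i (e + t) x) (at 0) \<and>
             ((\<lambda>h. u1 i (e + t) (x + h *\<^sub>R axis i 1)) has_real_derivative u2 i (e + t) x) (at 0)) \<and>
        ut (e + t) x = (\<Sum>i\<in>UNIV. u2 i (e + t) x)"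
      by blast
  qed
qed

text \<open>By the chain rule along the lines x + h e_i, the pure second derivatives are the
  diagonal entries of the Hessian, and their sum is its trace.\<close>

lemma heat_solution_imp_axiswise_caloric:
  fixes u :: "real \<Rightarrow> real^'a \<Rightarrow> real"
  assumes "heat_solution \<Omega> u"
  shows "axiswise_caloric \<Omega> u"
proof -
  obtain ut G H where
    u: "\<forall>t>0. \<forall>x\<in>\<Omega>. ((\<lambda>s. u s x) has_real_derivative ut t x) (at t) \<and>
        (u t has_derivative (\<lambda>h. G t x \<bullet> h)) (at x) \<and>
        (G t has_derivative (\<lambda>h. H t x *v h)) (at x) \<and> ut t x = trace (H t x)"
    using assms unfolding heat_solution_def by blast
  have line: "((\<lambda>h. x + h *\<^sub>R axis i 1) has_derivative (\<lambda>h. h *\<^sub>R axis i 1)) (at 0)"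
    for x :: "real^'a" and i
    by (auto intro!: derivative_eq_intros)
  show ?thesis
    unfolding axiswise_caloric_def
  proof (rule exI[of _ ut], rule exI[of _ "\<lambda>i t x. G t x $ i"], rule exI[of _ "\<lambda>i t x. H t x $ i $ i"],
      intro allI impI ballI conjI)
    fix t :: real and x :: "real^'a" and i :: 'a assume "t > 0" "x \<in> \<Omega>"
    note u' = u[rule_format, OF this]
    show "((\<lambda>s. u s x) has_real_derivative ut t x) (at t)" using u' by blast
    have Gx: "(u t has_derivative (\<lambda>h. G t x \<bullet> h)) (at (x + 0 *\<^sub>R axis i 1))"
      and Hx: "(G t has_derivative (\<lambda>h. H t x *v h)) (at (x + 0 *\<^sub>R axis i 1))"
      unfolding scaleR_zero_left add_0_right using u' by blast+
    show "ut t x = (\<Sum>i\<in>UNIV. H t x $ i $ i)" using u' by (simp add: trace_def)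
    show "((\<lambda>h. u t (x + h *\<^sub>R axis i 1)) has_real_derivative G t x $ i) (at 0)"
      using has_derivative_compose[OF line Gx]
      by (simp add: has_field_derivative_def inner_axis mult_commute_abs)
    have "((\<lambda>h. G t (x + h *\<^sub>R axis i 1) $ i) has_derivative (\<lambda>h. (H t x *v (h *\<^sub>R axis i 1)) $ i)) (at 0)"
      using bounded_linear.has_derivative[OF bounded_linear_vec_nth has_derivative_compose[OF line Hx]] .
    then show "((\<lambda>h. G t (x + h *\<^sub>R axis i 1) $ i) has_real_derivative H t x $ i $ i) (at 0)"
      by (simp add: has_field_derivative_def matrix_vector_mult_scaleR matrix_vector_mult_basis
          column_def mult.commute[of _ "H t x $ i $ i"])
  qed
qed

text \<open>\<open>h'\<close> is assumed differentiable at 0 only, so the argument goes through the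
  mean value theorem: D > 0 makes \<open>h'\<close> positive just to the right of the critical point
  0, and \<open>h\<close> would rise there.\<close>

lemma second_derivative_local_max:
  fixes h h' :: "real \<Rightarrow> real"
  assumes "e > 0" and h: "\<And>s. \<bar>s\<bar> < e \<Longrightarrow> (h has_real_derivative h' s) (at s)"
    and D: "(h' has_real_derivative D) (at 0)" and max: "\<And>s. \<bar>s\<bar> < e \<Longrightarrow> h s \<le> h 0"
  shows "D \<le> 0"
proof (rule ccontr)
  assume "\<not> D \<le> 0"
  then obtain d where "d > 0" and d: "\<And>s. 0 < s \<Longrightarrow> s < d \<Longrightarrow> h' 0 < h' s"
    using DERIV_pos_inc_right[OF D] by auto
  have "h' 0 = 0"
    by (rule DERIV_local_max[OF h[of 0] \<open>e > 0\<close>]) (use \<open>e > 0\<close> max in auto)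
  define r where "r = min d e / 2"
  have r: "0 < r" "r < d" "r < e" using \<open>d > 0\<close> \<open>e > 0\<close> by (auto simp: r_def)
  obtain z where z: "0 < z" "z < r" "h r - h 0 = (r - 0) * h' z"
    using MVT2[of 0 r h h'] h r by auto
  have "h' z > 0" using d[of z] z r \<open>h' 0 = 0\<close> by simp
  then have "r * h' z > 0" using r by simp
  with z have "h r > h 0" by simp
  with max[of r] r show False by simp
qed

text \<open>Near the frontier nothing is known of \<open>u\<close> beyond nonnegativity. But where v
  - u is large, \<open>v\<close> is large as well, and the bound on \<open>v\<close> at the frontier
  keeps this region away from it. The classical maximum argument with a penalty linear in t then
  takes place inside the domain.\<close>

proposition caloric_comparison:
  fixes u v :: "real \<Rightarrow> real^'n \<Rightarrow> real"
  assumes "open \<Omega>" "bounded \<Omega>" and "axiswise_caloric \<Omega> u" "axiswise_caloric \<Omega> v"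
    and cu: "continuous_on ({0<..} \<times> \<Omega>) (\<lambda>(t, x). u t x)"
    and cv: "continuous_on ({0<..} \<times> closure \<Omega>) (\<lambda>(t, x). v t x)"
    and u0: "\<And>t x. t > 0 \<Longrightarrow> x \<in> \<Omega> \<Longrightarrow> 0 \<le> u t x"
    and bdry: "\<And>t x. t > 0 \<Longrightarrow> x \<in> frontier \<Omega> \<Longrightarrow> v t x \<le> 0"
    and init: "\<And>\<delta>. \<delta> > 0 \<Longrightarrow> \<forall>\<^sub>F t in at_right 0. \<forall>x\<in>\<Omega>. v t x \<le> u t x + \<delta>"
    and "t1 > 0" "x1 \<in> \<Omega>"
  shows "v t1 x1 \<le> u t1 x1"
proof (rule ccontr)
  define w where "w t x = v t x - u t x" for t x
  define m where "m = w t1 x1"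
  assume "\<not> v t1 x1 \<le> u t1 x1"
  then have "m > 0" by (simp add: m_def w_def)
  \<comment> \<open>The slope makes the penalty at \<open>t1\<close> exactly half the supposed
    excess \<open>m\<close>, so the penalised maximum is at least m / 2.\<close>
  define c where "c = m / (2 * t1)"
  have "c > 0" "c * t1 = m / 2" using \<open>m > 0\<close> \<open>t1 > 0\<close> by (auto simp: c_def)
  have "axiswise_caloric \<Omega> w"
    unfolding w_def by (intro axiswise_caloric_diff assms)
  then obtain wt w1 w2 where
    w: "\<forall>t>0. \<forall>x\<in>\<Omega>. ((\<lambda>s. w s x) has_real_derivative wt t x) (at t) \<and>
        (\<forall>i. ((\<lambda>h. w t (x + h *\<^sub>R axis i 1)) has_real_derivative w1 i t x) (at 0) \<and>
             ((\<lambda>h. w1 i t (x + h *\<^sub>R axis i 1)) has_real_derivative w2 i t x) (at 0)) \<and>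
        wt t x = (\<Sum>i\<in>UNIV. w2 i t x)"
    unfolding axiswise_caloric_def by blast
  have "\<forall>\<^sub>F t in at_right 0. t < t1 \<and> (\<forall>x\<in>\<Omega>. v t x \<le> u t x + m / 4)"
  proof (rule eventually_conj)
    show "\<forall>\<^sub>F t in at_right 0. t < t1"
      using eventually_at_right_real[OF \<open>t1 > 0\<close>] by (rule eventually_mono) simp
    show "\<forall>\<^sub>F t in at_right 0. \<forall>x\<in>\<Omega>. v t x \<le> u t x + m / 4"
      using \<open>m > 0\<close> by (intro init) simp
  qed
  \<comment> \<open>The tolerance m / 4 lies below m / 2, which will keep the maximum off the
    starting time \<tau>.\<close>
  then obtain b where "b > 0" and b: "\<And>t. 0 < t \<Longrightarrow> t < b \<Longrightarrow> t < t1 \<and> (\<forall>x\<in>\<Omega>. v t x \<le> u t x + m / 4)"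
    unfolding eventually_at_right_field by blast
  define \<tau> where "\<tau> = b / 2"
  have "\<tau> > 0" "\<tau> < b" using \<open>b > 0\<close> by (auto simp: \<tau>_def)
  have "\<tau> < t1" using b[OF \<open>\<tau> > 0\<close> \<open>\<tau> < b\<close>] by simp
  define Q where "Q = {\<tau>..t1} \<times> closure \<Omega>"
  \<comment> \<open>\<open>S\<close> is cut out by \<open>v\<close> alone, which is continuous up to
    the frontier. This makes \<open>S\<close> compact; \<open>u\<close> enters only after
    \<open>S\<close> is known to lie over \<Omega>.\<close>
  define S where "S = Q \<inter> (\<lambda>p. v (fst p) (snd p) - c * fst p) -` {m / 2..}"
  have "compact Q"
    unfolding Q_def by (intro compact_Times) (use \<open>bounded \<Omega>\<close> in auto)
  have "continuous_on Q (\<lambda>p. v (fst p) (snd p))"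
    by (rule continuous_on_subset[OF cv[unfolded case_prod_unfold]]) (use \<open>\<tau> > 0\<close> in \<open>auto simp: Q_def\<close>)
  then have "closed S"
    unfolding S_def using \<open>compact Q\<close>
    by (intro continuous_closed_preimage continuous_intros) (auto simp: compact_imp_closed)
  then have "compact S"
    using compact_Int_closed[OF \<open>compact Q\<close>, of S] by (simp add: S_def)
  have S\<Omega>: "snd p \<in> \<Omega>" if "p \<in> S" for p
  proof (rule ccontr)
    assume "snd p \<notin> \<Omega>"
    with that have "snd p \<in> frontier \<Omega>" "fst p > 0"
      using \<open>open \<Omega>\<close> \<open>\<tau> > 0\<close> by (auto simp: S_def Q_def frontier_def interior_open)
    then have "v (fst p) (snd p) - c * fst p \<le> 0"
      using bdry[of "fst p" "snd p"] \<open>c > 0\<close> by (smt (verit) mult_pos_pos)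
    with that \<open>m > 0\<close> show False by (simp add: S_def)
  qed
  let ?F = "\<lambda>p. w (fst p) (snd p) - c * fst p"
  have "continuous_on S (\<lambda>p. v (fst p) (snd p))" "continuous_on S (\<lambda>p. u (fst p) (snd p))"
    by (rule continuous_on_subset[OF cv[unfolded case_prod_unfold]],
        use \<open>\<tau> > 0\<close> in \<open>force simp: S_def Q_def\<close>,
        rule continuous_on_subset[OF cu[unfolded case_prod_unfold]],
        use \<open>\<tau> > 0\<close> S\<Omega> in \<open>force simp: S_def Q_def\<close>)
  then have "continuous_on S ?F" unfolding w_def by (intro continuous_intros)
  moreover have p1: "(t1, x1) \<in> S"
    using \<open>\<tau> < t1\<close> \<open>x1 \<in> \<Omega>\<close> closure_subset[of \<Omega>] u0[OF \<open>t1 > 0\<close> \<open>x1 \<in> \<Omega>\<close>] \<open>c * t1 = m / 2\<close>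
    by (auto simp: S_def Q_def m_def w_def)
  ultimately obtain p where p: "p \<in> S" "\<And>q. q \<in> S \<Longrightarrow> ?F q \<le> ?F p"
    using continuous_attains_sup[OF \<open>compact S\<close>] by blast
  obtain t0 x0 where p0: "p = (t0, x0)" by fastforce
  have x0: "x0 \<in> \<Omega>" and t0: "\<tau> \<le> t0" "t0 \<le> t1"
    using S\<Omega>[OF p(1)] p(1) by (auto simp: p0 S_def Q_def)
  have F0: "m / 2 \<le> w t0 x0 - c * t0"
    using p(2)[OF p1] \<open>c * t1 = m / 2\<close> by (simp add: p0 m_def)
  \<comment> \<open>Points outside \<open>S\<close> cannot compete, because w \<le> v there: the
    maximum over \<open>S\<close> is the maximum over all times in [\<tau>, t1] and all of
    \<Omega>.\<close>
  have top: "w t x - c * t \<le> w t0 x0 - c * t0" if "\<tau> \<le> t" "t \<le> t1" "x \<in> \<Omega>" for t x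
  proof (cases "(t, x) \<in> S")
    case True
    with p(2)[OF True] show ?thesis by (simp add: p0)
  next
    case False
    then have "v t x - c * t < m / 2"
      using that closure_subset[of \<Omega>] by (auto simp: S_def Q_def)
    moreover have "w t x \<le> v t x" using u0[of t x] that \<open>\<tau> > 0\<close> by (simp add: w_def)
    ultimately show ?thesis using F0 by linarith
  qed
  have "t0 \<noteq> \<tau>"
  proof
    assume "t0 = \<tau>"
    then have "w t0 x0 \<le> m / 4" using b[OF \<open>\<tau> > 0\<close> \<open>\<tau> < b\<close>] x0 by (auto simp: w_def)
    moreover have "0 < c * t0" using \<open>c > 0\<close> t0 \<open>\<tau> > 0\<close> by simp
    ultimately show False using F0 \<open>m > 0\<close> by linarith
  qed
  with t0 \<open>\<tau> > 0\<close> have "t0 > \<tau>" "t0 > 0" by auto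
  with w x0 have wt: "((\<lambda>s. w s x0) has_real_derivative wt t0 x0) (at t0)"
    and heat: "wt t0 x0 = (\<Sum>i\<in>UNIV. w2 i t0 x0)" by blast+
  have "w2 i t0 x0 \<le> 0" for i
  proof -
    obtain e where "e > 0" and e: "ball x0 e \<subseteq> \<Omega>"
      using \<open>open \<Omega>\<close> x0 open_contains_ball by blast
    have in\<Omega>: "x0 + s *\<^sub>R axis i 1 \<in> \<Omega>" if "\<bar>s\<bar> < e" for s
      using e that by (auto simp: dist_norm norm_axis_1 subset_iff)
    show ?thesis
    proof (rule second_derivative_local_max[OF \<open>e > 0\<close>])
      fix s :: real assume s: "\<bar>s\<bar> < e"
      have "((\<lambda>h. w t0 ((x0 + s *\<^sub>R axis i 1) + h *\<^sub>R axis i 1)) has_real_derivative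
          w1 i t0 (x0 + s *\<^sub>R axis i 1)) (at 0)"
        using w in\<Omega>[OF s] \<open>t0 > 0\<close> by blast
      then show "((\<lambda>s. w t0 (x0 + s *\<^sub>R axis i 1)) has_real_derivative
          w1 i t0 (x0 + s *\<^sub>R axis i 1)) (at s)"
        using DERIV_shift[of "\<lambda>s. w t0 (x0 + s *\<^sub>R axis i 1)" _ 0 s]
        by (simp add: scaleR_add_left algebra_simps)
      show "w t0 (x0 + s *\<^sub>R axis i 1) \<le> w t0 (x0 + 0 *\<^sub>R axis i 1)"
        using top[of t0 "x0 + s *\<^sub>R axis i 1"] in\<Omega>[OF s] t0 by simp
    qed (use w x0 \<open>t0 > 0\<close> in blast)
  qed
  then have "wt t0 x0 \<le> 0" unfolding heat by (intro sum_nonpos) auto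
  moreover have "((\<lambda>s. w s x0 - c * s) has_real_derivative wt t0 x0 - c) (at t0)"
    using wt by (auto intro!: derivative_eq_intros)
  \<comment> \<open>The penalised function strictly decreases in time at its maximum, so it was
    larger slightly earlier. Only earlier times are usable, since \<open>t0\<close> may equal
    \<open>t1\<close>; there is room because t0 > \<tau>.\<close>
  ultimately obtain d where "d > 0" and d: "\<And>h. 0 < h \<Longrightarrow> h < d \<Longrightarrow> w t0 x0 - c * t0 < w (t0 - h) x0 - c * (t0 - h)"
    using DERIV_neg_dec_left[of "\<lambda>s. w s x0 - c * s" "wt t0 x0 - c" t0] \<open>c > 0\<close> by auto
  define h where "h = min d (t0 - \<tau>) / 2"
  have "0 < h" "h < d" "\<tau> \<le> t0 - h" "t0 - h \<le> t1"
    using \<open>d > 0\<close> \<open>t0 > \<tau>\<close> t0 by (auto simp: h_def min_def field_simps)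
  with d[of h] top[of "t0 - h" x0] x0 show False by auto
qed

section \<open>Derivatives of the Gauss kernel\<close>

text \<open>The constants are uniform for t in compact subintervals of (0, \<infinity>) and may
  degenerate as t tends to 0. This is the form a Weierstrass majorant for the series of images asks
  for.\<close>

definition gaussian_decay :: "(real \<Rightarrow> real^2 \<Rightarrow> real) \<Rightarrow> bool" where
  "gaussian_decay \<Phi> \<longleftrightarrow> continuous_on ({0<..} \<times> UNIV) (\<lambda>(t, w). \<Phi> t w) \<and>
    (\<forall>a b. 0 < a \<longrightarrow> a \<le> b \<longrightarrow> (\<exists>C\<ge>0. \<exists>c>0. \<forall>t\<in>{a..b}. \<forall>w. \<bar>\<Phi> t w\<bar> \<le> C * exp (- c * (norm w)\<^sup>2)))"

definition gauss_grad :: "2 \<Rightarrow> real \<Rightarrow> real^2 \<Rightarrow> real" where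
  "gauss_grad i t w = - (w $ i) / (2 * t) * gauss_kernel t w 0"

definition gauss_hess :: "2 \<Rightarrow> 2 \<Rightarrow> real \<Rightarrow> real^2 \<Rightarrow> real" where
  "gauss_hess i j t w =
    (w $ i * w $ j / (4 * t\<^sup>2) - (if i = j then 1 / (2 * t) else 0)) * gauss_kernel t w 0"

definition gauss_time :: "real \<Rightarrow> real^2 \<Rightarrow> real" where
  "gauss_time t w = ((norm w)\<^sup>2 / (4 * t\<^sup>2) - 1 / t) * gauss_kernel t w 0"

text \<open>Each derivative of the kernel in use is the kernel times a polynomial of degree at most
  2 in w, with coefficients bounded for t away from 0; this covers them all.\<close>

lemma gaussian_decay_poly_gauss:
  assumes "continuous_on ({0<..} \<times> UNIV) (\<lambda>(t, w). Q t w)"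
    and "\<And>a. a > 0 \<Longrightarrow> \<exists>C. \<forall>t\<ge>a. \<forall>w. \<bar>Q t w\<bar> \<le> C * (1 + (norm w)\<^sup>2)"
  shows "gaussian_decay (\<lambda>t w. Q t w * gauss_kernel t w 0)"
  unfolding gaussian_decay_def
proof (intro conjI allI impI)
  have "continuous_on ({0<..} \<times> UNIV) (\<lambda>p. Q (fst p) (snd p))"
    using assms(1) by (simp add: case_prod_unfold)
  then show "continuous_on ({0<..} \<times> UNIV) (\<lambda>(t, w). Q t w * gauss_kernel t w 0)"
    unfolding gauss_kernel_def case_prod_unfold by (intro continuous_intros) auto
next
  fix a b :: real assume "0 < a" "a \<le> b"
  then have "b > 0" by simp
  obtain C where C: "\<And>t w. a \<le> t \<Longrightarrow> \<bar>Q t w\<bar> \<le> C * (1 + (norm w)\<^sup>2)"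
    using assms(2)[OF \<open>0 < a\<close>] by blast
  have "C \<ge> 0" using C[of a 0] by simp
  \<comment> \<open>For t \<le> b the exponential is at most exp(-|w|^2 / (4 b)) = exp(-2 c |w|^2).
    Half of this decay is spent on the quadratic growth of \<open>Q\<close>.\<close>
  define c where "c = 1 / (8 * b)"
  have "c > 0" using \<open>b > 0\<close> by (simp add: c_def)
  define C' where "C' = C * (1 + 8 * b) * (1 / (4 * pi * a))"
  have "C' \<ge> 0" unfolding C'_def using \<open>C \<ge> 0\<close> \<open>0 < a\<close> \<open>b > 0\<close> by simp
  moreover have "\<bar>Q t w * gauss_kernel t w 0\<bar> \<le> C' * exp (- c * (norm w)\<^sup>2)"
    if t: "t \<in> {a..b}" for t w
  proof -
    have "t > 0" using t \<open>0 < a\<close> by simp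
    have s: "8 * b * (c * (norm w)\<^sup>2) = (norm w)\<^sup>2" using \<open>b > 0\<close> by (simp add: c_def)
    have "0 \<le> 8 * b" "0 \<le> c * (norm w)\<^sup>2" using \<open>b > 0\<close> \<open>c > 0\<close> by auto
    then have "1 + 8 * b * (c * (norm w)\<^sup>2) \<le> (1 + 8 * b) * (1 + c * (norm w)\<^sup>2)"
      by (simp add: algebra_simps)
    also have "\<dots> \<le> (1 + 8 * b) * exp (c * (norm w)\<^sup>2)"
      using \<open>b > 0\<close> by (intro mult_left_mono exp_ge_add_one_self) simp
    finally have "1 + (norm w)\<^sup>2 \<le> (1 + 8 * b) * exp (c * (norm w)\<^sup>2)" unfolding s .
    then have "C * (1 + (norm w)\<^sup>2) \<le> C * ((1 + 8 * b) * exp (c * (norm w)\<^sup>2))"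
      using \<open>C \<ge> 0\<close> by (rule mult_left_mono)
    with C[of t w] t have Q: "\<bar>Q t w\<bar> \<le> C * ((1 + 8 * b) * exp (c * (norm w)\<^sup>2))"
      by (meson atLeastAtMost_iff order.trans)
    have "(norm w)\<^sup>2 / (4 * b) \<le> (norm w)\<^sup>2 / (4 * t)"
      using t \<open>t > 0\<close> by (intro divide_left_mono) auto
    moreover have "(norm w)\<^sup>2 / (4 * b) = 2 * (c * (norm w)\<^sup>2)" by (simp add: c_def)
    ultimately have "exp (- (norm w)\<^sup>2 / (4 * t)) \<le> exp (- (2 * (c * (norm w)\<^sup>2)))"
      by simp
    moreover have "1 / (4 * pi * t) \<le> 1 / (4 * pi * a)"
      using t \<open>0 < a\<close> by (intro divide_left_mono) auto
    ultimately have g: "gauss_kernel t w 0 \<le> 1 / (4 * pi * a) * exp (- (2 * (c * (norm w)\<^sup>2)))"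
      unfolding gauss_kernel_def using \<open>0 < a\<close> by (simp only: diff_zero) (intro mult_mono, auto)
    have "\<bar>Q t w * gauss_kernel t w 0\<bar> = \<bar>Q t w\<bar> * gauss_kernel t w 0"
      using gauss_kernel_nonneg[of t w 0] \<open>t > 0\<close> by (simp add: abs_mult)
    also have "\<dots> \<le> C * ((1 + 8 * b) * exp (c * (norm w)\<^sup>2)) *
        (1 / (4 * pi * a) * exp (- (2 * (c * (norm w)\<^sup>2))))"
      using Q g gauss_kernel_nonneg[of t w 0] \<open>t > 0\<close> by (intro mult_mono) auto
    also have "\<dots> = C' * (exp (c * (norm w)\<^sup>2) * exp (- (2 * (c * (norm w)\<^sup>2))))"
      by (simp add: C'_def)
    also have "exp (c * (norm w)\<^sup>2) * exp (- (2 * (c * (norm w)\<^sup>2))) = exp (- c * (norm w)\<^sup>2)"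
      by (simp add: exp_add[symmetric])
    finally show ?thesis .
  qed
  ultimately show "\<exists>C\<ge>0. \<exists>c>0. \<forall>t\<in>{a..b}. \<forall>w. \<bar>Q t w * gauss_kernel t w 0\<bar> \<le> C * exp (- c * (norm w)\<^sup>2)"
    using \<open>c > 0\<close> by blast
qed

lemma component_abs_le: "\<bar>(w :: real^2) $ i\<bar> \<le> 1 + (norm w)\<^sup>2"
proof -
  have "\<bar>w $ i\<bar> \<le> norm w" by (rule component_le_norm_cart)
  also have "\<dots> \<le> 1 + (norm w)\<^sup>2" using sum_squares_bound[of "norm w" 1] norm_ge_zero[of w]
    by (simp only: power_one mult_1_right)
  finally show ?thesis .
qed

lemma gaussian_decay_gauss_kernel: "gaussian_decay (\<lambda>t w. gauss_kernel t w 0)"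
  using gaussian_decay_poly_gauss[of "\<lambda>_ _. 1"] by (force intro: exI[of _ 1])

lemma gaussian_decay_gauss_grad: "gaussian_decay (gauss_grad i)"
  unfolding gauss_grad_def
proof (rule gaussian_decay_poly_gauss)
  show "continuous_on ({0<..} \<times> UNIV) (\<lambda>(t :: real, w :: real^2). - (w $ i) / (2 * t))"
    unfolding case_prod_unfold by (intro continuous_intros) auto
  fix a :: real assume "a > 0"
  have "\<bar>- (w $ i) / (2 * t)\<bar> \<le> 1 / (2 * a) * (1 + (norm w)\<^sup>2)" if "t \<ge> a" for t and w :: "real^2"
  proof -
    have "\<bar>- (w $ i) / (2 * t)\<bar> = 1 / (2 * t) * \<bar>w $ i\<bar>" using that \<open>a > 0\<close> by (simp add: abs_mult)
    also have "\<dots> \<le> 1 / (2 * a) * (1 + (norm w)\<^sup>2)"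
      using that \<open>a > 0\<close> by (intro mult_mono component_abs_le divide_left_mono) auto
    finally show ?thesis .
  qed
  then show "\<exists>C. \<forall>t\<ge>a. \<forall>w. \<bar>- (w $ i) / (2 * t)\<bar> \<le> C * (1 + (norm w)\<^sup>2)" by blast
qed

text \<open>Serves the Hessian, with q = w_i w_j, and the time derivative, with q = |w|^2; in both
  cases n = |w|^2 and e = 1.\<close>

lemma quadratic_bound:
  fixes q n d a t e :: real
  assumes "\<bar>q\<bar> \<le> n" "\<bar>d\<bar> \<le> e / t" "a > 0" "t \<ge> a" "n \<ge> 0" "e \<ge> 0"
  shows "\<bar>q / (4 * t\<^sup>2) - d\<bar> \<le> (1 / (4 * a\<^sup>2) + e / a) * (1 + n)"
proof -
  have t: "a\<^sup>2 \<le> t\<^sup>2" using assms by (intro power_mono) auto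
  have "\<bar>q / (4 * t\<^sup>2)\<bar> = 1 / (4 * t\<^sup>2) * \<bar>q\<bar>" by (simp add: abs_mult)
  also have "\<dots> \<le> 1 / (4 * a\<^sup>2) * n"
    using t assms by (intro mult_mono divide_left_mono) auto
  finally have "\<bar>q / (4 * t\<^sup>2)\<bar> \<le> 1 / (4 * a\<^sup>2) * n" .
  moreover have "e / t \<le> e / a" using assms by (intro divide_left_mono) auto
  moreover have "0 \<le> 1 / (4 * a\<^sup>2)" "0 \<le> e / a * n" using assms by auto
  ultimately show ?thesis using assms(2) by (simp only: distrib_left distrib_right mult_1_right)
qed

lemma gaussian_decay_gauss_hess: "gaussian_decay (gauss_hess i j)"
  unfolding gauss_hess_def
proof (rule gaussian_decay_poly_gauss)
  show "continuous_on ({0<..} \<times> UNIV) (\<lambda>(t :: real, w :: real^2). w $ i * w $ j / (4 * t\<^sup>2) - (if i = j then 1 / (2 * t) else 0))"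
    unfolding case_prod_unfold by (cases "i = j") (auto intro!: continuous_intros)
  fix a :: real assume "a > 0"
  have "\<bar>w $ i * w $ j / (4 * t\<^sup>2) - (if i = j then 1 / (2 * t) else 0)\<bar> \<le>
      (1 / (4 * a\<^sup>2) + 1 / a) * (1 + (norm w)\<^sup>2)" if "t \<ge> a" for t and w :: "real^2"
  proof (rule quadratic_bound)
    show "\<bar>w $ i * w $ j\<bar> \<le> (norm w)\<^sup>2"
      unfolding abs_mult power2_eq_square by (intro mult_mono component_le_norm_cart) auto
    show "\<bar>if i = j then 1 / (2 * t) else 0\<bar> \<le> 1 / t"
      using \<open>a > 0\<close> that by (simp add: field_simps)
  qed (use \<open>a > 0\<close> that in auto)
  then show "\<exists>C. \<forall>t\<ge>a. \<forall>w. \<bar>w $ i * w $ j / (4 * t\<^sup>2) - (if i = j then 1 / (2 * t) else 0)\<bar> \<le> C * (1 + (norm w)\<^sup>2)"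
    by blast
qed

lemma gaussian_decay_gauss_time: "gaussian_decay gauss_time"
  unfolding gauss_time_def
proof (rule gaussian_decay_poly_gauss)
  show "continuous_on ({0<..} \<times> UNIV) (\<lambda>(t :: real, w :: real^2). (norm w)\<^sup>2 / (4 * t\<^sup>2) - 1 / t)"
    unfolding case_prod_unfold by (auto intro!: continuous_intros)
  fix a :: real assume "a > 0"
  have "\<bar>(norm w)\<^sup>2 / (4 * t\<^sup>2) - 1 / t\<bar> \<le> (1 / (4 * a\<^sup>2) + 1 / a) * (1 + (norm w)\<^sup>2)"
    if "t \<ge> a" for t and w :: "real^2"
    by (rule quadratic_bound) (use \<open>a > 0\<close> that in auto)
  then show "\<exists>C. \<forall>t\<ge>a. \<forall>w::real^2. \<bar>(norm w)\<^sup>2 / (4 * t\<^sup>2) - 1 / t\<bar> \<le> C * (1 + (norm w)\<^sup>2)"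
    by blast
qed

lemma norm_square_real2: "(norm (w :: real^2))\<^sup>2 = (w $ 1)\<^sup>2 + (w $ 2)\<^sup>2"
  by (simp add: power2_norm_eq_inner inner_vec_def sum_2) (simp add: power2_eq_square)

lemma gauss_kernel_has_time_derivative:
  assumes "t > 0"
  shows "((\<lambda>s. gauss_kernel s w 0) has_real_derivative gauss_time t w) (at t)"
proof -
  have "((\<lambda>s. 1 / (4 * pi * s) * exp (- (norm w)\<^sup>2 / (4 * s))) has_real_derivative
      - 1 / (4 * pi * t\<^sup>2) * exp (- (norm w)\<^sup>2 / (4 * t)) +
      1 / (4 * pi * t) * (exp (- (norm w)\<^sup>2 / (4 * t)) * ((norm w)\<^sup>2 / (4 * t\<^sup>2)))) (at t)"
    using assms by (auto intro!: derivative_eq_intros simp: power2_eq_square field_simps)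
  moreover have "- 1 / (4 * pi * t\<^sup>2) * exp (- (norm w)\<^sup>2 / (4 * t)) +
      1 / (4 * pi * t) * (exp (- (norm w)\<^sup>2 / (4 * t)) * ((norm w)\<^sup>2 / (4 * t\<^sup>2))) = gauss_time t w"
    using assms by (simp add: gauss_time_def gauss_kernel_def power2_eq_square field_simps)
  ultimately show ?thesis by (simp add: gauss_kernel_def)
qed

lemma gauss_kernel_has_gradient:
  assumes "t > 0"
  shows "((\<lambda>w. gauss_kernel t w 0) has_derivative (\<lambda>h. \<Sum>i\<in>UNIV. gauss_grad i t w * h $ i)) (at w)"
proof -
  have "((\<lambda>w. 1 / (4 * pi * t) * exp (- ((w $ 1)\<^sup>2 + (w $ 2)\<^sup>2) / (4 * t))) has_derivative
     (\<lambda>h. 1 / (4 * pi * t) * (exp (- ((w $ 1)\<^sup>2 + (w $ 2)\<^sup>2) / (4 * t)) *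
        (- (2 * (w $ 1) * h $ 1 + 2 * (w $ 2) * h $ 2) / (4 * t))))) (at w)"
    using assms by (auto intro!: derivative_eq_intros bounded_linear_imp_has_derivative bounded_linear_vec_nth
        simp: power2_eq_square fun_eq_iff) (simp add: field_simps)
  also have "(\<lambda>h. 1 / (4 * pi * t) * (exp (- ((w $ 1)\<^sup>2 + (w $ 2)\<^sup>2) / (4 * t)) *
        (- (2 * (w $ 1) * h $ 1 + 2 * (w $ 2) * h $ 2) / (4 * t)))) =
      (\<lambda>h. \<Sum>i\<in>UNIV. gauss_grad i t w * h $ i)"
    using assms by (simp add: gauss_grad_def gauss_kernel_def norm_square_real2 sum_2 fun_eq_iff field_simps)
  finally show ?thesis by (simp add: gauss_kernel_def norm_square_real2)
qed

lemma gauss_grad_has_gradient: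
  assumes "t > 0"
  shows "(gauss_grad i t has_derivative (\<lambda>h. \<Sum>j\<in>UNIV. gauss_hess i j t w * h $ j)) (at w)"
proof -
  have "((\<lambda>w. - (w $ i) / (2 * t)) has_derivative (\<lambda>h. - (h $ i) / (2 * t))) (at w)"
    using assms bounded_linear_imp_has_derivative[OF bounded_linear_vec_nth, of i "at w"]
    by (auto intro!: derivative_eq_intros)
  from has_derivative_mult[OF this gauss_kernel_has_gradient[OF assms]]
  have "(gauss_grad i t has_derivative (\<lambda>h. - (w $ i) / (2 * t) * (\<Sum>j\<in>UNIV. gauss_grad j t w * h $ j) +
      - (h $ i) / (2 * t) * gauss_kernel t w 0)) (at w)"
    by (simp add: gauss_grad_def[abs_def])
  also have "(\<lambda>h. - (w $ i) / (2 * t) * (\<Sum>j\<in>UNIV. gauss_grad j t w * h $ j) +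
      - (h $ i) / (2 * t) * gauss_kernel t w 0) = (\<lambda>h. \<Sum>j\<in>UNIV. gauss_hess i j t w * h $ j)"
    using assms exhaust_2[of i]
    by (auto simp: gauss_hess_def gauss_grad_def sum_2 fun_eq_iff power2_eq_square field_simps)
  finally show ?thesis .
qed

lemma gauss_time_eq_trace:
  assumes "t > 0"
  shows "gauss_time t w = (\<Sum>i\<in>UNIV. gauss_hess i i t w)"
proof -
  have "(norm w)\<^sup>2 / (4 * t\<^sup>2) - 1 / t =
      (w $ 1 * w $ 1 / (4 * t\<^sup>2) - 1 / (2 * t)) + (w $ 2 * w $ 2 / (4 * t\<^sup>2) - 1 / (2 * t))"
    unfolding norm_square_real2 by (simp add: add_divide_distrib power2_eq_square)
  then show ?thesis
    unfolding gauss_time_def gauss_hess_def sum_2 by (simp only: distrib_right) simp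
qed

section \<open>Series of images\<close>

text \<open>The analytic half of the method: convergence and termwise differentiation rest on
  isometries and the Gaussian summability of a single orbit. The domain and the sign pattern come in
  later.\<close>

locale image_series =
  fixes R :: "nat \<Rightarrow> real^2 \<Rightarrow> real^2" and \<sigma> :: "nat \<Rightarrow> real"
  assumes abs_sign: "\<bar>\<sigma> l\<bar> = 1"
    and isometry: "dist (R l x) (R l y) = dist x y"
    and summable_orbit: "c > 0 \<Longrightarrow> summable (\<lambda>l. exp (- c * (norm (R l 0))\<^sup>2))"
begin

definition images :: "(real \<Rightarrow> real^2 \<Rightarrow> real) \<Rightarrow> real \<Rightarrow> real^2 \<Rightarrow> real^2 \<Rightarrow> real" where
  "images \<Phi> t x z = (\<Sum>l. \<sigma> l * \<Phi> t (x - R l z))"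

lemma continuous_on_isometry [continuous_intros]:
  "continuous_on S f \<Longrightarrow> continuous_on S (\<lambda>p. R l (f p))"
proof -
  have "continuous_on UNIV (R l)"
    unfolding continuous_on_iff by (auto simp: isometry)
  then show "continuous_on S f \<Longrightarrow> continuous_on S (\<lambda>p. R l (f p))"
    by (rule continuous_on_compose2) auto
qed

text \<open>For x and z in a fixed ball, |x - R l z| and |R l 0| differ by at most 2 r, so a
  Gaussian bound in the former becomes one that depends on l alone.\<close>

lemma orbit_distance:
  assumes "norm x \<le> r" "norm z \<le> r"
  shows "(norm (R l 0))\<^sup>2 \<le> 2 * (norm (x - R l z))\<^sup>2 + 8 * r\<^sup>2"
proof -
  define d where "d = norm (x - R l z)"
  have "norm (R l 0) \<le> norm (R l z) + dist (R l 0) (R l z)"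
    by norm
  also have "dist (R l 0) (R l z) = norm z" by (simp add: isometry)
  also have "norm (R l z) \<le> norm x + d" unfolding d_def by norm
  finally have "norm (R l 0) \<le> d + 2 * r" using assms by simp
  then have "(norm (R l 0))\<^sup>2 \<le> (d + 2 * r)\<^sup>2" by (intro power_mono) auto
  also have "\<dots> \<le> 2 * d\<^sup>2 + 8 * r\<^sup>2"
    using zero_le_power2[of "d - 2 * r"] by (simp add: power2_eq_square algebra_simps)
  finally show ?thesis unfolding d_def .
qed

lemma gaussian_majorant:
  assumes "c > 0"
  shows "summable (\<lambda>l. exp (4 * c * r\<^sup>2) * exp (- (c / 2) * (norm (R l 0))\<^sup>2))"
    and "norm x \<le> r \<Longrightarrow> norm z \<le> r \<Longrightarrow>
      exp (- c * (norm (x - R l z))\<^sup>2) \<le> exp (4 * c * r\<^sup>2) * exp (- (c / 2) * (norm (R l 0))\<^sup>2)"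
proof -
  show "summable (\<lambda>l. exp (4 * c * r\<^sup>2) * exp (- (c / 2) * (norm (R l 0))\<^sup>2))"
    using assms by (intro summable_mult summable_orbit) simp
  assume "norm x \<le> r" "norm z \<le> r"
  from mult_left_mono[OF orbit_distance[OF this, of l], of "c / 2"] assms
  show "exp (- c * (norm (x - R l z))\<^sup>2) \<le> exp (4 * c * r\<^sup>2) * exp (- (c / 2) * (norm (R l 0))\<^sup>2)"
    by (simp add: exp_add[symmetric] algebra_simps)
qed

text \<open>One summable \<open>M\<close> for all points near a given one: the input to every
  Weierstrass test below.\<close>

lemma images_majorant:
  assumes "gaussian_decay \<Phi>" "0 < a" "a \<le> b"
  obtains M where "summable M"
    "\<And>l t x z. t \<in> {a..b} \<Longrightarrow> norm x \<le> r \<Longrightarrow> norm z \<le> r \<Longrightarrow> norm (\<sigma> l * \<Phi> t (x - R l z)) \<le> M l"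
proof -
  obtain C c where "C \<ge> 0" "c > 0" and
    C: "\<And>t w. t \<in> {a..b} \<Longrightarrow> \<bar>\<Phi> t w\<bar> \<le> C * exp (- c * (norm w)\<^sup>2)"
    using assms unfolding gaussian_decay_def by meson
  define M where "M l = C * (exp (4 * c * r\<^sup>2) * exp (- (c / 2) * (norm (R l 0))\<^sup>2))" for l
  have "summable M" unfolding M_def by (intro summable_mult gaussian_majorant(1) \<open>c > 0\<close>)
  moreover have "norm (\<sigma> l * \<Phi> t (x - R l z)) \<le> M l"
    if "t \<in> {a..b}" "norm x \<le> r" "norm z \<le> r" for l t x z
  proof -
    have "norm (\<sigma> l * \<Phi> t (x - R l z)) = \<bar>\<Phi> t (x - R l z)\<bar>"
      by (simp add: abs_mult abs_sign)
    also have "\<dots> \<le> C * exp (- c * (norm (x - R l z))\<^sup>2)" by (rule C[OF that(1)])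
    also have "\<dots> \<le> M l"
      unfolding M_def by (intro mult_left_mono gaussian_majorant(2) that \<open>c > 0\<close> \<open>C \<ge> 0\<close>)
    finally show ?thesis .
  qed
  ultimately show ?thesis using that by blast
qed

lemma summable_images_norm:
  assumes "gaussian_decay \<Phi>" "t > 0"
  shows "summable (\<lambda>l. norm (\<sigma> l * \<Phi> t (x - R l z)))"
proof -
  obtain M where "summable M" and
    M: "\<And>l s x' z'. s \<in> {t..t} \<Longrightarrow> norm x' \<le> max (norm x) (norm z) \<Longrightarrow>
      norm z' \<le> max (norm x) (norm z) \<Longrightarrow> norm (\<sigma> l * \<Phi> s (x' - R l z')) \<le> M l"
    using images_majorant[OF assms(1,2) order_refl] by blast
  show ?thesis by (rule summable_comparison_test'[OF \<open>summable M\<close>, of 0]) (use M in simp)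
qed

lemmas summable_images = summable_norm_cancel[OF summable_images_norm]

text \<open>Continuity is joint in \<open>z\<close> too, because the series is later integrated over
  \<open>z\<close>.\<close>

lemma continuous_on_images:
  assumes "gaussian_decay \<Phi>"
  shows "continuous_on ({0<..} \<times> UNIV \<times> UNIV) (\<lambda>(t, x, z). images \<Phi> t x z)"
proof -
  have "isCont (\<lambda>(t, x, z). images \<Phi> t x z) (t, x, z)" if "t > 0" for t x z
  proof -
    define r where "r = 1 + norm x + norm z"
    define N where "N = {t / 2<..<2 * t} \<times> ball (0 :: real^2) r \<times> ball (0 :: real^2) r"
    obtain M where "summable M" and
      M: "\<And>l s x z. s \<in> {t / 2..2 * t} \<Longrightarrow> norm x \<le> r \<Longrightarrow> norm z \<le> r \<Longrightarrow>
        norm (\<sigma> l * \<Phi> s (x - R l z)) \<le> M l"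
      using images_majorant[OF assms, of "t / 2" "2 * t"] \<open>t > 0\<close> by auto
    have "uniform_limit N (\<lambda>n p. \<Sum>l<n. \<sigma> l * \<Phi> (fst p) (fst (snd p) - R l (snd (snd p))))
        (\<lambda>p. \<Sum>l. \<sigma> l * \<Phi> (fst p) (fst (snd p) - R l (snd (snd p)))) sequentially"
      by (rule Weierstrass_m_test[OF M \<open>summable M\<close>]) (auto simp: N_def)
    moreover have "continuous_on N (\<lambda>p. \<Phi> (fst p) (fst (snd p) - R l (snd (snd p))))" for l
    proof -
      have "continuous_on ({0<..} \<times> UNIV) (\<lambda>q. \<Phi> (fst q) (snd q))"
        using assms by (simp add: gaussian_decay_def case_prod_unfold)
      note continuous_on_compose2[OF this, of N "\<lambda>p. (fst p, fst (snd p) - R l (snd (snd p)))"]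
      moreover have "continuous_on N (\<lambda>p. (fst p, fst (snd p) - R l (snd (snd p))))"
        by (intro continuous_intros)
      moreover have "(\<lambda>p. (fst p, fst (snd p) - R l (snd (snd p)))) ` N \<subseteq> {0<..} \<times> UNIV"
        using \<open>t > 0\<close> by (auto simp: N_def)
      ultimately show ?thesis by simp
    qed
    then have "\<forall>\<^sub>F n in sequentially. continuous_on N
        (\<lambda>p. \<Sum>l<n. \<sigma> l * \<Phi> (fst p) (fst (snd p) - R l (snd (snd p))))"
      by (intro always_eventually allI continuous_on_sum continuous_on_mult_left)
    ultimately have "continuous_on N (\<lambda>p. \<Sum>l. \<sigma> l * \<Phi> (fst p) (fst (snd p) - R l (snd (snd p))))"
      by (rule uniform_limit_theorem[OF _ _ trivial_limit_sequentially, rotated])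
    moreover have "open N" "(t, x, z) \<in> N"
      unfolding N_def using \<open>t > 0\<close> by (auto intro!: open_Times simp: r_def add_pos_nonneg)
    ultimately show ?thesis
      by (simp add: continuous_on_eq_continuous_at images_def case_prod_unfold)
  qed
  then show ?thesis by (auto intro!: continuous_at_imp_continuous_on)
qed

lemma continuous_on_images_compose:
  assumes "gaussian_decay \<Phi>" "continuous_on S f" "continuous_on S g" "continuous_on S h"
    and "\<And>p. p \<in> S \<Longrightarrow> f p > 0"
  shows "continuous_on S (\<lambda>p. images \<Phi> (f p) (g p) (h p))"
proof -
  have "continuous_on S (\<lambda>p. (f p, g p, h p))"
    by (intro continuous_on_Pair assms)
  moreover have "(\<lambda>p. (f p, g p, h p)) ` S \<subseteq> {0<..} \<times> UNIV \<times> UNIV"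
    using assms(5) by auto
  ultimately show ?thesis
    using continuous_on_compose2[OF continuous_on_images[OF assms(1)], of S "\<lambda>p. (f p, g p, h p)"]
    by simp
qed

lemma images_has_time_derivative:
  assumes "gaussian_decay \<Phi>" "gaussian_decay \<Phi>'" "t > 0"
    and "\<And>t w. t > 0 \<Longrightarrow> ((\<lambda>s. \<Phi> s w) has_real_derivative \<Phi>' t w) (at t)"
  shows "((\<lambda>s. images \<Phi> s x z) has_real_derivative images \<Phi>' t x z) (at t)"
proof -
  define r where "r = max (norm x) (norm z)"
  define S where "S = {t / 2<..<2 * t}"
  obtain M where "summable M" and
    M: "\<And>l s x z. s \<in> {t / 2..2 * t} \<Longrightarrow> norm x \<le> r \<Longrightarrow> norm z \<le> r \<Longrightarrow>
      norm (\<sigma> l * \<Phi>' s (x - R l z)) \<le> M l"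
    using images_majorant[OF assms(2), of "t / 2" "2 * t"] \<open>t > 0\<close> by auto
  show ?thesis
    unfolding images_def
  proof (rule has_field_derivative_series'(2))
    show "convex S" "t \<in> S" "t \<in> interior S" using \<open>t > 0\<close> by (auto simp: S_def)
    show "((\<lambda>s. \<sigma> l * \<Phi> s (x - R l z)) has_real_derivative \<sigma> l * \<Phi>' s (x - R l z)) (at s within S)"
      if "s \<in> S" for l s
      using that \<open>t > 0\<close> DERIV_cmult[OF has_field_derivative_at_within[OF assms(4)]] by (simp add: S_def)
    show "uniformly_convergent_on S (\<lambda>n s. \<Sum>l<n. \<sigma> l * \<Phi>' s (x - R l z))"
      by (rule Weierstrass_m_test'[OF M \<open>summable M\<close>]) (auto simp: S_def r_def)
    show "summable (\<lambda>l. \<sigma> l * \<Phi> t (x - R l z))" by (rule summable_images assms)+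
  qed
qed

lemma images_has_gradient:
  fixes \<Phi>' :: "2 \<Rightarrow> real \<Rightarrow> real^2 \<Rightarrow> real"
  assumes "gaussian_decay \<Phi>" "\<And>i. gaussian_decay (\<Phi>' i)" "t > 0"
    and D: "\<And>w. (\<Phi> t has_derivative (\<lambda>h. \<Sum>i\<in>UNIV. \<Phi>' i t w * h $ i)) (at w)"
  shows "((\<lambda>x. images \<Phi> t x z) has_derivative (\<lambda>h. \<Sum>i\<in>UNIV. images (\<Phi>' i) t x z * h $ i)) (at x)"
proof -
  define r where "r = norm x + norm z + 1"
  define S where "S = ball (0 :: real^2) r"
  have "x \<in> S" "open S" by (auto simp: S_def r_def add_nonneg_pos)
  have lim: "uniform_limit S (\<lambda>n x. \<Sum>l<n. \<sigma> l * \<Phi>' i t (x - R l z)) (\<lambda>x. images (\<Phi>' i) t x z) sequentially" for i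
  proof -
    obtain M where "summable M" and
      M: "\<And>l s x z. s \<in> {t..t} \<Longrightarrow> norm x \<le> r \<Longrightarrow> norm z \<le> r \<Longrightarrow>
        norm (\<sigma> l * \<Phi>' i s (x - R l z)) \<le> M l"
      using images_majorant[OF assms(2) \<open>t > 0\<close> order_refl] by blast
    show ?thesis unfolding images_def
      by (rule Weierstrass_m_test[OF M \<open>summable M\<close>]) (auto simp: S_def r_def)
  qed
  have "\<exists>g. \<forall>x\<in>S. (\<lambda>l. \<sigma> l * \<Phi> t (x - R l z)) sums g x \<and>
      (g has_derivative (\<lambda>h. \<Sum>i\<in>UNIV. images (\<Phi>' i) t x z * h $ i)) (at x within S)"
  proof (rule has_derivative_series)
    show "convex S" by (simp add: S_def)
    show "x \<in> S" by fact
    show "(\<lambda>l. \<sigma> l * \<Phi> t (x - R l z)) sums (\<Sum>l. \<sigma> l * \<Phi> t (x - R l z))"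
      by (intro summable_sums summable_images assms)
    fix l and y :: "real^2" assume "y \<in> S"
    have "((\<lambda>y. y - R l z) has_derivative (\<lambda>h. h)) (at y within S)"
      by (auto intro!: derivative_eq_intros)
    from has_derivative_mult_right[OF has_derivative_compose[OF this D], of "\<sigma> l"]
    show "((\<lambda>y. \<sigma> l * \<Phi> t (y - R l z)) has_derivative
        (\<lambda>h. \<sigma> l * (\<Sum>i\<in>UNIV. \<Phi>' i t (y - R l z) * h $ i))) (at y within S)" .
  next
    \<comment> \<open>Each of the two partial derivatives gets e / 2, so that their total error
      stays within e * norm h.\<close>
    fix e :: real assume "e > 0"
    have "\<forall>\<^sub>F n in sequentially. \<forall>i. \<forall>y\<in>S.
        dist (\<Sum>l<n. \<sigma> l * \<Phi>' i t (y - R l z)) (images (\<Phi>' i) t y z) < e / 2"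
      using lim \<open>e > 0\<close> by (intro eventually_all_finite uniform_limitD) auto
    then show "\<forall>\<^sub>F n in sequentially. \<forall>y\<in>S. \<forall>h.
        norm ((\<Sum>l<n. \<sigma> l * (\<Sum>i\<in>UNIV. \<Phi>' i t (y - R l z) * h $ i)) -
          (\<Sum>i\<in>UNIV. images (\<Phi>' i) t y z * h $ i)) \<le> e * norm h"
    proof eventually_elim
      case (elim n)
      show ?case
      proof (intro ballI allI)
        fix y and h :: "real^2" assume "y \<in> S"
        have "(\<Sum>l<n. \<sigma> l * (\<Sum>i\<in>UNIV. \<Phi>' i t (y - R l z) * h $ i)) =
            (\<Sum>i\<in>UNIV. (\<Sum>l<n. \<sigma> l * \<Phi>' i t (y - R l z)) * h $ i)"
          by (simp add: sum_2 distrib_left sum.distrib sum_distrib_right mult.assoc)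
        then have "norm ((\<Sum>l<n. \<sigma> l * (\<Sum>i\<in>UNIV. \<Phi>' i t (y - R l z) * h $ i)) -
            (\<Sum>i\<in>UNIV. images (\<Phi>' i) t y z * h $ i)) =
            norm (\<Sum>i\<in>UNIV. ((\<Sum>l<n. \<sigma> l * \<Phi>' i t (y - R l z)) - images (\<Phi>' i) t y z) * h $ i)"
          by (simp add: left_diff_distrib sum_subtractf)
        also have "\<dots> \<le> (\<Sum>i\<in>(UNIV :: 2 set). e / 2 * norm h)"
        proof (rule sum_norm_le)
          fix i :: 2
          have "dist (\<Sum>l<n. \<sigma> l * \<Phi>' i t (y - R l z)) (images (\<Phi>' i) t y z) < e / 2"
            using elim \<open>y \<in> S\<close> by blast
          then show "norm (((\<Sum>l<n. \<sigma> l * \<Phi>' i t (y - R l z)) - images (\<Phi>' i) t y z) * h $ i) \<le> e / 2 * norm h"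
            unfolding norm_mult dist_norm
            using \<open>e > 0\<close>
            by (intro mult_mono) (auto simp: component_le_norm_cart)
        qed
        finally show "norm ((\<Sum>l<n. \<sigma> l * (\<Sum>i\<in>UNIV. \<Phi>' i t (y - R l z) * h $ i)) -
          (\<Sum>i\<in>UNIV. images (\<Phi>' i) t y z * h $ i)) \<le> e * norm h" by (simp add: sum_2)
      qed
    qed
  qed
  then obtain g where g: "\<And>y. y \<in> S \<Longrightarrow> (\<lambda>l. \<sigma> l * \<Phi> t (y - R l z)) sums g y"
    and g': "(g has_derivative (\<lambda>h. \<Sum>i\<in>UNIV. images (\<Phi>' i) t x z * h $ i)) (at x within S)"
    using \<open>x \<in> S\<close> by blast
  have "(g has_derivative (\<lambda>h. \<Sum>i\<in>UNIV. images (\<Phi>' i) t x z * h $ i)) (at x)"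
    using g' at_within_open[OF \<open>x \<in> S\<close> \<open>open S\<close>] by simp
  then show ?thesis
    by (rule has_derivative_transform_within_open[OF _ \<open>open S\<close> \<open>x \<in> S\<close>])
      (use g in \<open>simp add: images_def sums_iff\<close>)
qed

text \<open>For data \<open>f\<close> supported in \<Omega> this will be the solution with initial
  values \<open>f\<close>. Integrating over a compact box containing \<Omega>, rather than over
  \<Omega>, brings it under the rules for parameter integrals over boxes and leaves the value
  unchanged.\<close>

definition smoothed :: "(real \<Rightarrow> real^2 \<Rightarrow> real) \<Rightarrow> real^2 \<Rightarrow> real^2 \<Rightarrow> (real^2 \<Rightarrow> real) \<Rightarrow>
    real \<Rightarrow> real^2 \<Rightarrow> real" where
  "smoothed \<Phi> a b f t x = integral (cbox a b) (\<lambda>z. images \<Phi> t x z * f z)"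

lemma continuous_on_smoothed:
  assumes "gaussian_decay \<Phi>" "continuous_on UNIV f"
  shows "continuous_on ({0<..} \<times> UNIV) (\<lambda>(t, x). smoothed \<Phi> a b f t x)"
proof -
  have "continuous_on (({0<..} \<times> UNIV) \<times> cbox a b) (\<lambda>q. images \<Phi> (fst (fst q)) (snd (fst q)) (snd q) * f (snd q))"
    by (intro continuous_intros continuous_on_images_compose[OF assms(1)] continuous_on_compose2[OF assms(2)]) auto
  from integral_continuous_on_param[of _ a b "\<lambda>p z. images \<Phi> (fst p) (snd p) z * f z", unfolded case_prod_unfold, OF this]
  show ?thesis by (simp add: smoothed_def case_prod_unfold)
qed

lemma smoothed_integrable:
  assumes "gaussian_decay \<Phi>" "continuous_on UNIV f" "t > 0"
  shows "(\<lambda>z. images \<Phi> t x z * f z) integrable_on cbox a b"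
  by (intro integrable_continuous continuous_intros continuous_on_images_compose[OF assms(1)]
      continuous_on_subset[OF assms(2)]) (use assms(3) in auto)

lemma smoothed_has_time_derivative:
  assumes "gaussian_decay \<Phi>" "gaussian_decay \<Phi>'" "continuous_on UNIV f" "t > 0"
    and "\<And>t w. t > 0 \<Longrightarrow> ((\<lambda>s. \<Phi> s w) has_real_derivative \<Phi>' t w) (at t)"
  shows "((\<lambda>s. smoothed \<Phi> a b f s x) has_real_derivative smoothed \<Phi>' a b f t x) (at t)"
proof -
  have "((\<lambda>s. smoothed \<Phi> a b f s x) has_real_derivative smoothed \<Phi>' a b f t x) (at t within {0<..})"
    unfolding smoothed_def
  proof (rule leibniz_rule_field_derivative)
    show "((\<lambda>s. images \<Phi> s x z * f z) has_real_derivative images \<Phi>' s x z * f z) (at s within {0<..})"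
      if "s \<in> {0<..}" for s z
      using that
      by (simp add: DERIV_cmult_right has_field_derivative_at_within
          images_has_time_derivative[OF assms(1,2) _ assms(5)])
    show "(\<lambda>z. images \<Phi> s x z * f z) integrable_on cbox a b" if "s \<in> {0<..}" for s
      using that by (intro smoothed_integrable[OF assms(1,3)]) auto
    show "continuous_on ({0<..} \<times> cbox a b) (\<lambda>(s, z). images \<Phi>' s x z * f z)"
      unfolding case_prod_unfold
      by (intro continuous_intros continuous_on_images_compose[OF assms(2)] continuous_on_compose2[OF assms(3)]) auto
  qed (use \<open>t > 0\<close> in auto)
  then show ?thesis using at_within_open[of t "{0<..}"] \<open>t > 0\<close> by simp
qed

text \<open>The Leibniz rule differentiates in one real parameter, here the displacement along an
  axis. This is the reason for working with \<open>axiswise_caloric\<close>.\<close>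

lemma smoothed_has_axis_derivative:
  fixes \<Phi>' :: "2 \<Rightarrow> real \<Rightarrow> real^2 \<Rightarrow> real"
  assumes "gaussian_decay \<Phi>" "\<And>i. gaussian_decay (\<Phi>' i)" "continuous_on UNIV f" "t > 0"
    and "\<And>w. (\<Phi> t has_derivative (\<lambda>h. \<Sum>i\<in>UNIV. \<Phi>' i t w * h $ i)) (at w)"
  shows "((\<lambda>h. smoothed \<Phi> a b f t (x + h *\<^sub>R axis i 1)) has_real_derivative smoothed (\<Phi>' i) a b f t x) (at 0)"
proof -
  have "((\<lambda>h. smoothed \<Phi> a b f t (x + h *\<^sub>R axis i 1)) has_real_derivative
      smoothed (\<Phi>' i) a b f t (x + 0 *\<^sub>R axis i 1)) (at 0 within UNIV)"
    unfolding smoothed_def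
  proof (rule leibniz_rule_field_derivative)
    fix s :: real and z :: "real^2"
    have line: "((\<lambda>h. x + h *\<^sub>R axis i 1) has_derivative (\<lambda>h. h *\<^sub>R axis i 1)) (at s)"
      by (auto intro!: derivative_eq_intros)
    have "(\<Sum>j\<in>UNIV. images (\<Phi>' j) t y z * (h *\<^sub>R axis i 1) $ j) = images (\<Phi>' i) t y z * h" for h y
      using exhaust_2[of i] by (auto simp: sum_2 axis_def)
    from has_derivative_compose[OF line images_has_gradient[OF assms(1,2,4,5)], of z, unfolded this]
    have "((\<lambda>h. images \<Phi> t (x + h *\<^sub>R axis i 1) z) has_real_derivative
        images (\<Phi>' i) t (x + s *\<^sub>R axis i 1) z) (at s)"
      unfolding has_field_derivative_def .
    then show "((\<lambda>h. images \<Phi> t (x + h *\<^sub>R axis i 1) z * f z) has_real_derivative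
        images (\<Phi>' i) t (x + s *\<^sub>R axis i 1) z * f z) (at s within UNIV)"
      by (rule DERIV_cmult_right)
    show "(\<lambda>z. images \<Phi> t (x + s *\<^sub>R axis i 1) z * f z) integrable_on cbox a b"
      by (rule smoothed_integrable[OF assms(1,3,4)])
    show "continuous_on (UNIV \<times> cbox a b) (\<lambda>(s, z). images (\<Phi>' i) t (x + s *\<^sub>R axis i 1) z * f z)"
      unfolding case_prod_unfold using \<open>t > 0\<close>
      by (intro continuous_intros continuous_on_images_compose[OF assms(2)] continuous_on_compose2[OF assms(3)]) auto
  qed auto
  then show ?thesis by simp
qed

section \<open>The image kernel and its integrals as solutions of the heat equation\<close>

definition image_kernel :: "real \<Rightarrow> real^2 \<Rightarrow> real^2 \<Rightarrow> real" where
  "image_kernel = images (\<lambda>t w. gauss_kernel t w 0)"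

lemma images_sum_hess:
  assumes "t > 0"
  shows "images gauss_time t x z = (\<Sum>i\<in>UNIV. images (gauss_hess i i) t x z)"
  using assms summable_images[OF gaussian_decay_gauss_hess \<open>t > 0\<close>]
  by (simp add: images_def gauss_time_eq_trace sum_2 distrib_left suminf_add)

lemma heat_solution_image_kernel: "heat_solution \<Omega> (\<lambda>t x. image_kernel t x z)"
  unfolding heat_solution_def
proof (intro exI conjI allI impI ballI)
  let ?G = "\<lambda>t x. \<chi> i. images (gauss_grad i) t x z"
  let ?H = "\<lambda>t x. \<chi> i j. images (gauss_hess i j) t x z"
  show "continuous_on ({0<..} \<times> \<Omega>) (\<lambda>(t, x). image_kernel t x z)"
    unfolding case_prod_unfold image_kernel_def
    by (intro continuous_on_images_compose gaussian_decay_gauss_kernel continuous_intros) auto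
  show "continuous_on ({0<..} \<times> \<Omega>) (\<lambda>(t, x). images gauss_time t x z)"
    unfolding case_prod_unfold
    by (intro continuous_on_images_compose gaussian_decay_gauss_time continuous_intros) auto
  show "continuous_on ({0<..} \<times> \<Omega>) (\<lambda>(t, x). ?G t x)"
    unfolding case_prod_unfold
    by (intro continuous_on_vec_lambda continuous_on_images_compose gaussian_decay_gauss_grad continuous_intros) auto
  show "continuous_on ({0<..} \<times> \<Omega>) (\<lambda>(t, x). ?H t x)"
    unfolding case_prod_unfold
    by (intro continuous_on_vec_lambda continuous_on_images_compose gaussian_decay_gauss_hess continuous_intros) auto
  fix t :: real and x assume "t > 0" "x \<in> \<Omega>"
  show "((\<lambda>s. image_kernel s x z) has_real_derivative images gauss_time t x z) (at t)"
    unfolding image_kernel_def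
    by (intro images_has_time_derivative gaussian_decay_gauss_kernel gaussian_decay_gauss_time
        gauss_kernel_has_time_derivative \<open>t > 0\<close>)
  show "((\<lambda>x. image_kernel t x z) has_derivative (\<lambda>h. ?G t x \<bullet> h)) (at x)"
    using images_has_gradient[OF gaussian_decay_gauss_kernel gaussian_decay_gauss_grad \<open>t > 0\<close>
        gauss_kernel_has_gradient[OF \<open>t > 0\<close>], of z x]
    by (simp add: image_kernel_def inner_vec_def)
  have "((\<lambda>x. images (gauss_grad i) t x z) has_derivative (\<lambda>h. (?H t x *v h) $ i)) (at x)" for i
    using images_has_gradient[OF gaussian_decay_gauss_grad gaussian_decay_gauss_hess \<open>t > 0\<close>
        gauss_grad_has_gradient[OF \<open>t > 0\<close>], of i z x]
    by (simp add: matrix_vector_mult_def)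
  then show "(?G t has_derivative (\<lambda>h. ?H t x *v h)) (at x)"
    by (subst has_derivative_componentwise_within) (auto simp: Basis_vec_def inner_axis)
  show "images gauss_time t x z = trace (?H t x)"
    using images_sum_hess[OF \<open>t > 0\<close>] by (simp add: trace_def)
qed

lemma axiswise_caloric_smoothed:
  assumes "continuous_on UNIV f"
  shows "axiswise_caloric \<Omega> (smoothed (\<lambda>t w. gauss_kernel t w 0) a b f)"
  unfolding axiswise_caloric_def
proof (rule exI[of _ "smoothed gauss_time a b f"], rule exI[of _ "\<lambda>i. smoothed (gauss_grad i) a b f"],
    rule exI[of _ "\<lambda>i. smoothed (gauss_hess i i) a b f"], intro allI impI ballI conjI)
  fix t :: real and x and i :: 2 assume "t > 0"
  show "((\<lambda>s. smoothed (\<lambda>t w. gauss_kernel t w 0) a b f s x) has_real_derivative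
      smoothed gauss_time a b f t x) (at t)"
    by (intro smoothed_has_time_derivative gaussian_decay_gauss_kernel gaussian_decay_gauss_time
        gauss_kernel_has_time_derivative \<open>t > 0\<close> assms)
  show "((\<lambda>h. smoothed (\<lambda>t w. gauss_kernel t w 0) a b f t (x + h *\<^sub>R axis i 1)) has_real_derivative
      smoothed (gauss_grad i) a b f t x) (at 0)"
    by (intro smoothed_has_axis_derivative gaussian_decay_gauss_kernel gaussian_decay_gauss_grad
        gauss_kernel_has_gradient \<open>t > 0\<close> assms)
  show "((\<lambda>h. smoothed (gauss_grad i) a b f t (x + h *\<^sub>R axis i 1)) has_real_derivative
      smoothed (gauss_hess i i) a b f t x) (at 0)"
    by (rule smoothed_has_axis_derivative[OF gaussian_decay_gauss_grad gaussian_decay_gauss_hess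
        assms \<open>t > 0\<close> gauss_grad_has_gradient[OF \<open>t > 0\<close>]])
  show "smoothed gauss_time a b f t x = (\<Sum>i\<in>UNIV. smoothed (gauss_hess i i) a b f t x)"
    using smoothed_integrable[OF gaussian_decay_gauss_hess assms \<open>t > 0\<close>, of _ _ x a b]
    by (simp add: smoothed_def images_sum_hess[OF \<open>t > 0\<close>] sum_2 distrib_right integral_add)
qed

end

section \<open>Heat kernels by the method of images\<close>

text \<open>The last assumption is the method of images in abstract form: a symmetry \<rho> fixing
  the frontier point permutes the images through \<pi> and reverses all signs. By
  \<open>R_0\<close>, disjointness also says that no image with l \<noteq> 0 meets \<Omega>.\<close>

locale image_system =
  fixes \<Omega> :: "(real^2) set" and R :: "nat \<Rightarrow> real^2 \<Rightarrow> real^2" and \<sigma> :: "nat \<Rightarrow> real"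
  assumes open_domain: "open \<Omega>" and bounded_domain: "bounded \<Omega>" and nonempty_domain: "\<Omega> \<noteq> {}"
    and R_0: "R 0 = id" and sign_0: "\<sigma> 0 = 1" and abs_sign: "\<bar>\<sigma> l\<bar> = 1"
    and isometry: "dist (R l x) (R l y) = dist x y" and surj: "surj (R l)"
    and disjoint_images: "l \<noteq> m \<Longrightarrow> x \<in> \<Omega> \<Longrightarrow> y \<in> \<Omega> \<Longrightarrow> R l x \<noteq> R m y"
    and boundary_reflection: "x \<in> frontier \<Omega> \<Longrightarrow> \<exists>\<rho> \<pi>. bij \<pi> \<and> \<rho> x = x \<and>
      (\<forall>y z. dist (\<rho> y) (\<rho> z) = dist y z) \<and> (\<forall>l y. \<rho> (R l y) = R (\<pi> l) y) \<and> (\<forall>l. \<sigma> (\<pi> l) = - \<sigma> l)"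
begin

text \<open>
  The images of a small ball in \<open>\<Omega>\<close> are disjoint balls of equal area, so the sum over the orbit
  is dominated by a Gaussian integral.
\<close>

lemma summable_gauss_orbit:
  assumes "c > 0"
  shows "summable (\<lambda>l. exp (- c * (norm (R l 0))\<^sup>2))"
proof -
  obtain x0 where "x0 \<in> \<Omega>" using nonempty_domain by blast
  then obtain r where "r > 0" and r: "ball x0 r \<subseteq> \<Omega>"
    using open_domain open_contains_ball by blast
  define B where "B l = ball (R l x0) r" for l
  define V where "V = measure lborel (ball (0 :: real^2) r)"
  have "V > 0" unfolding V_def using \<open>r > 0\<close> by simp
  have V: "measure lborel (B l) = V" for l
    unfolding V_def B_def using \<open>r > 0\<close> by (simp add: content_ball)
  have disj: "B l \<inter> B m = {}" if "l \<noteq> m" for l m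
  proof (rule ccontr)
    assume "B l \<inter> B m \<noteq> {}"
    then obtain w where w: "w \<in> B l" "w \<in> B m" by blast
    obtain x y where xy: "w = R l x" "w = R m y" using surj by (metis surjD)
    have "x \<in> ball x0 r" using w(1) by (simp add: B_def xy(1) isometry)
    moreover have "y \<in> ball x0 r" using w(2) by (simp add: B_def xy(2) isometry)
    ultimately have "x \<in> \<Omega>" "y \<in> \<Omega>" using r by blast+
    then show False using disjoint_images[OF that] xy by metis
  qed
  \<comment> \<open>This choice gives the Gauss kernel the exponent c / 2 * |w|^2. The rate is
    halved because (a + b)^2 \<le> 2 a^2 + 2 b^2 doubles |R l 0|^2.\<close>
  define t where "t = 1 / (2 * c)"
  have "t > 0" using assms by (simp add: t_def)
  define D where "D = norm x0 + r"
  define E where "E = exp (c * D\<^sup>2) * (4 * pi * t)"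
  have "E \<ge> 0" using \<open>t > 0\<close> by (simp add: E_def)
  have le: "exp (- c * (norm (R l 0))\<^sup>2) \<le> E * gauss_kernel t w 0" if "w \<in> B l" for l w
  proof -
    have "norm w \<le> norm (R l 0) + dist (R l x0) (R l 0) + dist (R l x0) w" by norm
    then have "norm w \<le> norm (R l 0) + D" using that by (simp add: B_def isometry D_def)
    then have "(norm w)\<^sup>2 \<le> (norm (R l 0) + D)\<^sup>2" by (intro power_mono) auto
    also have "\<dots> \<le> 2 * (norm (R l 0))\<^sup>2 + 2 * D\<^sup>2"
      using zero_le_power2[of "norm (R l 0) - D"] by (simp add: power2_eq_square algebra_simps)
    finally have "c / 2 * (norm w)\<^sup>2 \<le> c / 2 * (2 * (norm (R l 0))\<^sup>2 + 2 * D\<^sup>2)"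
      using assms by (intro mult_left_mono) auto
    then have "- c * (norm (R l 0))\<^sup>2 \<le> c * D\<^sup>2 + - (c / 2 * (norm w)\<^sup>2)"
      by (simp add: algebra_simps)
    then have "exp (- c * (norm (R l 0))\<^sup>2) \<le> exp (c * D\<^sup>2) * exp (- (c / 2 * (norm w)\<^sup>2))"
      unfolding exp_add[symmetric] by simp
    also have "exp (- (c / 2 * (norm w)\<^sup>2)) = 4 * pi * t * gauss_kernel t w 0"
      using assms by (simp add: gauss_kernel_def t_def)
    finally show ?thesis by (simp add: E_def mult.assoc)
  qed
  have "(\<Sum>l\<le>n. exp (- c * (norm (R l 0))\<^sup>2)) \<le> E / V" for n
  proof -
    have int_B: "integrable lborel (\<lambda>w. exp (- c * (norm (R l 0))\<^sup>2) * indicator (B l) w)" for l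
      unfolding B_def
      by (intro integrable_mult_right integrable_real_indicator emeasure_lborel_ball_finite) simp
    have "(\<Sum>l\<le>n. exp (- c * (norm (R l 0))\<^sup>2)) * V =
        (\<Sum>l\<le>n. LINT w|lborel. exp (- c * (norm (R l 0))\<^sup>2) * indicator (B l) w)"
      by (simp add: sum_distrib_right V)
    also have "\<dots> = (LINT w|lborel. (\<Sum>l\<le>n. exp (- c * (norm (R l 0))\<^sup>2) * indicator (B l) w))"
      using int_B by (subst Bochner_Integration.integral_sum) auto
    also have "\<dots> \<le> (LINT w|lborel. E * gauss_kernel t w 0)"
    proof (rule integral_mono)
      show "integrable lborel (\<lambda>w. \<Sum>l\<le>n. exp (- c * (norm (R l 0))\<^sup>2) * indicator (B l) w)"
        using int_B by (intro Bochner_Integration.integrable_sum)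
      show "integrable lborel (\<lambda>w. E * gauss_kernel t w 0)"
        using integrable_gauss_kernel[OF \<open>t > 0\<close>] by simp
      fix w
      have nonneg: "0 \<le> E * gauss_kernel t w 0"
        using \<open>E \<ge> 0\<close> \<open>t > 0\<close> by (intro mult_nonneg_nonneg gauss_kernel_nonneg) auto
      show "(\<Sum>l\<le>n. exp (- c * (norm (R l 0))\<^sup>2) * indicator (B l) w) \<le> E * gauss_kernel t w 0"
      proof (cases "\<exists>m\<le>n. w \<in> B m")
        case True
        then obtain m where m: "m \<le> n" "w \<in> B m" by blast
        then have "w \<notin> B l" if "l \<noteq> m" for l using disj[OF that] by blast
        then have "(\<Sum>l\<le>n. exp (- c * (norm (R l 0))\<^sup>2) * indicator (B l) w) =
            (\<Sum>l\<le>n. if l = m then exp (- c * (norm (R l 0))\<^sup>2) else 0)"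
          using m by (intro sum.cong) (auto simp: indicator_def)
        also have "\<dots> = exp (- c * (norm (R m 0))\<^sup>2)" using m by simp
        finally show ?thesis using le[OF m(2)] by simp
      next
        case False
        then have "(\<Sum>l\<le>n. exp (- c * (norm (R l 0))\<^sup>2) * indicator (B l) w) = 0"
          by (intro sum.neutral) (auto simp: indicator_def)
        then show ?thesis using nonneg by simp
      qed
    qed
    also have "\<dots> = E" using integral_gauss_kernel[OF \<open>t > 0\<close>] by simp
    finally show ?thesis using \<open>V > 0\<close> by (simp add: field_simps)
  qed
  then show ?thesis by (intro bounded_imp_summable) auto
qed

sublocale image_series R \<sigma>
  by unfold_locales (use abs_sign isometry summable_gauss_orbit in auto)

text \<open>Since \<rho> is an isometry fixing \<open>x\<close>, image \<pi> l is as far from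
  \<open>x\<close> as image l and carries the opposite sign. Absolute convergence permits reindexing
  by \<pi>, which turns the sum into its negative.\<close>

lemma image_kernel_frontier:
  assumes "x \<in> frontier \<Omega>" "t > 0"
  shows "image_kernel t x z = 0"
proof -
  obtain \<rho> \<pi> where "bij \<pi>" and \<rho>: "\<rho> x = x" "\<And>y z. dist (\<rho> y) (\<rho> z) = dist y z"
    "\<And>l y. \<rho> (R l y) = R (\<pi> l) y" and \<sigma>: "\<And>l. \<sigma> (\<pi> l) = - \<sigma> l"
    using boundary_reflection[OF assms(1)] by metis
  define a where "a l = \<sigma> l * gauss_kernel t (x - R l z) 0" for l
  have "norm (x - R (\<pi> l) z) = norm (x - R l z)" for l
    using \<rho>(2)[of x "R l z"] by (simp add: \<rho>(1,3) dist_norm)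
  then have a: "a (\<pi> l) = - a l" for l by (simp add: a_def \<sigma> gauss_kernel_def)
  have "(a has_sum image_kernel t x z) UNIV"
    using summable_images_norm[OF gaussian_decay_gauss_kernel \<open>t > 0\<close>, of x z]
      summable_sums[OF summable_images[OF gaussian_decay_gauss_kernel \<open>t > 0\<close>, of x z]]
    unfolding a_def image_kernel_def images_def by (intro norm_summable_imp_has_sum)
  moreover from this have "((\<lambda>l. a (\<pi> l)) has_sum image_kernel t x z) UNIV"
    using has_sum_reindex_bij_betw[OF \<open>bij \<pi>\<close>, of a] by simp
  then have "(a has_sum - image_kernel t x z) UNIV"
    unfolding a by (simp add: has_sum_uminus)
  ultimately have "image_kernel t x z = - image_kernel t x z" by (rule has_sum_unique)
  then show ?thesis by simp
qed

text \<open>Only the term l = 0 is singular. All other images of \<open>z\<close> keep a fixed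
  distance from every point of \<Omega>, even from those near the frontier; the compactness of
  \<open>K\<close> in \<Omega> supplies this distance.\<close>

lemma image_kernel_near_gauss_kernel:
  assumes "compact K" "K \<subseteq> \<Omega>" "\<delta> > 0"
  shows "\<forall>\<^sub>F t in at_right 0. \<forall>x\<in>\<Omega>. \<forall>z\<in>K. \<bar>image_kernel t x z - gauss_kernel t x z\<bar> \<le> \<delta>"
proof -
  obtain d where "d > 0" and d: "(\<Union>z\<in>K. ball z d) \<subseteq> \<Omega>"
    using compact_subset_open_imp_ball_epsilon_subset[OF assms(1) open_domain assms(2)] .
  obtain r where r: "\<forall>x\<in>\<Omega>. norm x \<le> r" using bounded_domain unfolding bounded_iff by blast
  \<comment> \<open>Pulling \<open>x\<close> back by \<open>R l\<close> lands outside \<Omega>,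
    hence at distance at least \<open>d\<close> from \<open>z\<close>; the isometry
    \<open>R l\<close> carries this over to \<open>x\<close> and \<open>R l z\<close>.\<close>
  have far: "d \<le> norm (x - R l z)" if "l \<noteq> 0" "x \<in> \<Omega>" "z \<in> K" for l x z
  proof -
    obtain x' where x': "x = R l x'" using surj by (metis surjD)
    then have "x' \<notin> \<Omega>"
      using disjoint_images[OF \<open>l \<noteq> 0\<close>, of x' x] \<open>x \<in> \<Omega>\<close> by (auto simp: R_0)
    then have "x' \<notin> ball z d" using d \<open>z \<in> K\<close> by blast
    then show ?thesis
      using isometry[of l x' z] by (simp add: x' dist_norm[symmetric] dist_commute)
  qed
  \<comment> \<open>The exponent n^2 / (4 t) is split into equal halves. One gives exp(-q / t) with
    q = d^2 / 8, which beats the factor 1 / t; the other is at least n^2 / 8 for t \<le> 1 and leads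
    to the summable \<open>M\<close>.\<close>
  define M where "M l = exp (4 * (1 / 8) * r\<^sup>2) * exp (- ((1 / 8) / 2) * (norm (R l 0))\<^sup>2)" for l
  have "summable M" unfolding M_def by (rule gaussian_majorant(1)) simp
  define q where "q = d\<^sup>2 / 8"
  have "q > 0" using \<open>d > 0\<close> by (simp add: q_def)
  define E where "E t = 1 / (4 * pi * t) * exp (- q / t)" for t
  have bound: "\<bar>image_kernel t x z - gauss_kernel t x z\<bar> \<le> E t * (\<Sum>l. M (Suc l))"
    if "0 < t" "t \<le> 1" "x \<in> \<Omega>" "z \<in> K" for t x z
  proof -
    define a where "a l = \<sigma> l * gauss_kernel t (x - R l z) 0" for l
    have sa: "summable (\<lambda>l. norm (a l))"
      unfolding a_def by (rule summable_images_norm[OF gaussian_decay_gauss_kernel \<open>t > 0\<close>])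
    have sa': "summable (\<lambda>l. norm (a (Suc l)))"
      using sa by (subst summable_Suc_iff)
    have "E t \<ge> 0" using \<open>t > 0\<close> by (simp add: E_def)
    have le: "norm (a (Suc l)) \<le> E t * M (Suc l)" for l
    proof -
      define n where "n = norm (x - R (Suc l) z)"
      have "d\<^sup>2 \<le> n\<^sup>2" unfolding n_def using far[of "Suc l"] that \<open>d > 0\<close> by (intro power_mono) auto
      then have "d\<^sup>2 / (8 * t) \<le> n\<^sup>2 / (8 * t)" using \<open>t > 0\<close> by (intro divide_right_mono) auto
      moreover have "n\<^sup>2 / 8 \<le> n\<^sup>2 / (8 * t)" using that by (intro divide_left_mono) auto
      moreover have "q / t = d\<^sup>2 / (8 * t)" "n\<^sup>2 / (4 * t) = n\<^sup>2 / (8 * t) + n\<^sup>2 / (8 * t)"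
        using \<open>t > 0\<close> by (simp_all add: q_def)
      ultimately have "- n\<^sup>2 / (4 * t) \<le> - q / t + - (1 / 8) * n\<^sup>2" by simp
      then have "exp (- n\<^sup>2 / (4 * t)) \<le> exp (- q / t) * exp (- (1 / 8) * n\<^sup>2)"
        unfolding exp_add[symmetric] exp_le_cancel_iff .
      also have "\<dots> \<le> exp (- q / t) * M (Suc l)"
        unfolding n_def M_def using r that \<open>K \<subseteq> \<Omega>\<close>
        by (intro mult_left_mono gaussian_majorant(2)) auto
      finally have "1 / (4 * pi * t) * exp (- n\<^sup>2 / (4 * t)) \<le> 1 / (4 * pi * t) * (exp (- q / t) * M (Suc l))"
        using \<open>t > 0\<close> by (intro mult_left_mono) auto
      then show ?thesis
        using abs_sign[of "Suc l"] \<open>t > 0\<close> unfolding a_def n_def E_def gauss_kernel_def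
        by (simp add: abs_mult)
    qed
    have sS: "summable (\<lambda>l. M (Suc l))" using \<open>summable M\<close> by (simp add: summable_Suc_iff)
    have "image_kernel t x z = (\<Sum>l. a (Suc l)) + a 0"
      unfolding image_kernel_def images_def a_def[symmetric]
      using suminf_split_head[OF summable_norm_cancel[OF sa]] by simp
    then have "\<bar>image_kernel t x z - gauss_kernel t x z\<bar> = norm (\<Sum>l. a (Suc l))"
      by (simp add: a_def R_0 sign_0 gauss_kernel_diff[of t x z])
    also have "\<dots> \<le> (\<Sum>l. norm (a (Suc l)))"
      by (rule summable_norm[OF sa'])
    also have "\<dots> \<le> (\<Sum>l. E t * M (Suc l))"
      using sa' sS by (intro suminf_le le summable_mult)
    also have "\<dots> = E t * (\<Sum>l. M (Suc l))" using sS by (rule suminf_mult)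
    finally show ?thesis .
  qed
  have "(E \<longlongrightarrow> 0) (at_right 0)"
    unfolding E_def using \<open>q > 0\<close> by real_asymp
  then have "((\<lambda>t. E t * (\<Sum>l. M (Suc l))) \<longlongrightarrow> 0) (at_right 0)"
    by (rule tendsto_mult_left_zero)
  then have "\<forall>\<^sub>F t in at_right 0. E t * (\<Sum>l. M (Suc l)) < \<delta>"
    using \<open>\<delta> > 0\<close> by (rule order_tendstoD)
  moreover have "\<forall>\<^sub>F t in at_right 0. t \<in> {0<..<1::real}"
    by (rule eventually_at_right_real) simp
  ultimately show ?thesis
    by eventually_elim (use bound in force)
qed

end

section \<open>Integrals of compactly supported functions\<close>

lemma integrable_compact_support:
  fixes f :: "'a::euclidean_space \<Rightarrow> real"
  assumes "continuous_on K f" "compact K" "\<And>x. x \<notin> K \<Longrightarrow> f x = 0"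
  shows "integrable lborel f"
proof -
  have "(\<lambda>x. indicator K x *\<^sub>R f x) = f" using assms(3) by (auto simp: indicator_def fun_eq_iff)
  with borel_integrable_compact[OF assms(2,1)] show ?thesis by simp
qed

lemma set_integral_superset_support:
  fixes f g :: "'a::euclidean_space \<Rightarrow> real"
  assumes "\<And>x. x \<notin> S \<Longrightarrow> g x = 0" "\<And>x. x \<in> S \<Longrightarrow> f x = g x"
  shows "(LINT x:S|lborel. f x) = (LINT x|lborel. g x)"
  unfolding set_lebesgue_integral_def
  by (rule Bochner_Integration.integral_cong) (use assms in \<open>auto simp: indicator_def\<close>)

lemma integral_cbox_superset_support:
  fixes f :: "'a::euclidean_space \<Rightarrow> real"
  assumes "continuous_on K f" "compact K" "\<And>x. x \<notin> K \<Longrightarrow> f x = 0" "K \<subseteq> cbox a b"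
  shows "integral (cbox a b) f = (LINT x|lborel. f x)"
proof -
  have "(LINT x|lborel. f x) = integral UNIV f"
    using integral_lborel[OF integrable_compact_support[OF assms(1-3)]] by simp
  also have "f = (\<lambda>x. if x \<in> cbox a b then f x else 0)" 
  proof
    show "f x = (if x \<in> cbox a b then f x else 0)" for x using assms(3)[of x] assms(4) by auto
  qed
  then have "integral UNIV f = integral UNIV (\<lambda>x. if x \<in> cbox a b then f x else 0)" by simp
  also have "\<dots> = integral (cbox a b) f" by (rule integral_restrict_UNIV)
  finally show ?thesis by simp
qed

section \<open>Initial values, positivity and minimality of the image kernel\<close>

context image_system
begin

text \<open>\<open>p\<close> stands for the image kernel as a function of either space variable: the
  initial condition integrates over the first, \<open>smoothed\<close> over the second.\<close>

lemma integral_image_kernel_near: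
  fixes f p :: "real^2 \<Rightarrow> real"
  assumes f: "continuous_on UNIV f" "compact K" "\<And>z. z \<notin> K \<Longrightarrow> f z = 0"
    and p: "continuous_on UNIV p" "\<And>z. z \<in> K \<Longrightarrow> \<bar>p z - gauss_kernel t x z\<bar> \<le> \<delta>" and "\<delta> \<ge> 0"
  shows "\<bar>(LINT z|lborel. p z * f z) - (LINT z|lborel. gauss_kernel t x z * f z)\<bar> \<le>
    \<delta> * (LINT z|lborel. \<bar>f z\<bar>)"
proof -
  \<comment> \<open>\<open>t\<close> is unrestricted here; at t = 0 division by zero makes the
    kernel vanish identically.\<close>
  have cg: "continuous_on UNIV (\<lambda>z. gauss_kernel t x z)"
    unfolding gauss_kernel_def by (cases "t = 0") (auto intro!: continuous_intros)
  note sub = continuous_on_subset[OF _ subset_UNIV]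
  have i1: "integrable lborel (\<lambda>z. p z * f z)"
    by (rule integrable_compact_support[OF _ f(2)]) (use f p in \<open>auto intro!: continuous_on_mult intro: sub\<close>)
  have i2: "integrable lborel (\<lambda>z. gauss_kernel t x z * f z)"
    by (rule integrable_compact_support[OF _ f(2)]) (use f cg in \<open>auto intro!: continuous_on_mult intro: sub\<close>)
  have i3: "integrable lborel f" by (rule integrable_compact_support[OF _ f(2,3)]) (use f(1) in \<open>auto intro: sub\<close>)
  have "\<bar>(LINT z|lborel. p z * f z) - (LINT z|lborel. gauss_kernel t x z * f z)\<bar> =
      \<bar>LINT z|lborel. p z * f z - gauss_kernel t x z * f z\<bar>"
    using i1 i2 by simp
  also have "\<dots> \<le> (LINT z|lborel. \<bar>p z * f z - gauss_kernel t x z * f z\<bar>)" by simp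
  also have "\<dots> \<le> (LINT z|lborel. \<delta> * \<bar>f z\<bar>)"
  proof (rule integral_mono)
    show "integrable lborel (\<lambda>z. \<bar>p z * f z - gauss_kernel t x z * f z\<bar>)" using i1 i2 by simp
    show "integrable lborel (\<lambda>z. \<delta> * \<bar>f z\<bar>)" using i3 by simp
    fix z
    have "\<bar>p z - gauss_kernel t x z\<bar> * \<bar>f z\<bar> \<le> \<delta> * \<bar>f z\<bar>"
      using p(2)[of z] f(3)[of z] by (cases "z \<in> K") (auto intro: mult_right_mono)
    then show "\<bar>p z * f z - gauss_kernel t x z * f z\<bar> \<le> \<delta> * \<bar>f z\<bar>"
      by (simp add: left_diff_distrib[symmetric] abs_mult)
  qed
  also have "\<dots> = \<delta> * (LINT z|lborel. \<bar>f z\<bar>)" by simp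
  finally show ?thesis .
qed

lemma continuous_on_image_kernel:
  assumes "t > 0" "continuous_on S g" "continuous_on S h"
  shows "continuous_on S (\<lambda>p. image_kernel t (g p) (h p))"
  unfolding image_kernel_def
  by (rule continuous_on_images_compose[OF gaussian_decay_gauss_kernel continuous_on_const assms(2,3) assms(1)])

text \<open>The negated kernel is compared with the zero function: it vanishes on the frontier, and
  for small t it stays below any \<delta> > 0, because the kernel is \<delta>-close to the
  nonnegative Gauss kernel.\<close>

lemma image_kernel_nonneg:
  assumes "t > 0" "x \<in> \<Omega>" "z \<in> \<Omega>"
  shows "0 \<le> image_kernel t x z"
proof -
  have "- image_kernel t x z \<le> 0"
  proof (rule caloric_comparison[OF open_domain bounded_domain axiswise_caloric_const _ _ _ _ _ _ assms(1,2)])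
    show "axiswise_caloric \<Omega> (\<lambda>t x. - image_kernel t x z)"
      using axiswise_caloric_diff[OF axiswise_caloric_const[of \<Omega> 0]
          heat_solution_imp_axiswise_caloric[OF heat_solution_image_kernel]] by simp
    show "continuous_on ({0<..} \<times> closure \<Omega>) (\<lambda>(t, x). - image_kernel t x z)"
      unfolding case_prod_unfold image_kernel_def
      by (intro continuous_intros continuous_on_images_compose gaussian_decay_gauss_kernel) auto
    fix \<delta> :: real assume "\<delta> > 0"
    have "\<forall>\<^sub>F t in at_right 0. \<forall>x\<in>\<Omega>. \<forall>z\<in>{z}. \<bar>image_kernel t x z - gauss_kernel t x z\<bar> \<le> \<delta>"
      by (rule image_kernel_near_gauss_kernel) (use assms(3) \<open>\<delta> > 0\<close> in auto)
    then show "\<forall>\<^sub>F t in at_right 0. \<forall>x\<in>\<Omega>. - image_kernel t x z \<le> 0 + \<delta>"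
      using eventually_at_right_less[of "0 :: real"]
    proof eventually_elim
      case (elim t)
      show ?case
      proof
        fix x assume "x \<in> \<Omega>"
        then have "\<bar>image_kernel t x z - gauss_kernel t x z\<bar> \<le> \<delta>" using elim by blast
        moreover have "0 \<le> gauss_kernel t x z" using elim by (intro gauss_kernel_nonneg) simp
        ultimately show "- image_kernel t x z \<le> 0 + \<delta>" by linarith
      qed
    qed
  qed (auto simp: image_kernel_frontier)
  then show ?thesis by simp
qed

lemma image_kernel_initial:
  assumes "continuous_on UNIV \<phi>" "compact K" "K \<subseteq> \<Omega>" "\<And>x. x \<notin> K \<Longrightarrow> \<phi> x = 0" "y \<in> \<Omega>"
  shows "((\<lambda>t. LINT x:\<Omega>|lborel. image_kernel t x y * \<phi> x) \<longlongrightarrow> \<phi> y) (at_right 0)"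
proof (rule tendstoI)
  fix e :: real assume "e > 0"
  define I where "I = (LINT x|lborel. \<bar>\<phi> x\<bar>)"
  have "I \<ge> 0" by (simp add: I_def)
  \<comment> \<open>I + 1 in place of I avoids a division by zero when \<phi> vanishes
    identically.\<close>
  define \<delta> where "\<delta> = e / (2 * (I + 1))"
  have "\<delta> > 0" using \<open>e > 0\<close> \<open>I \<ge> 0\<close> by (simp add: \<delta>_def)
  have "\<delta> * I < e / 2" using \<open>e > 0\<close> \<open>I \<ge> 0\<close> by (simp add: \<delta>_def field_simps)
  have "\<forall>\<^sub>F t in at_right 0. \<forall>x\<in>\<Omega>. \<forall>z\<in>{y}. \<bar>image_kernel t x z - gauss_kernel t x z\<bar> \<le> \<delta>"
    by (rule image_kernel_near_gauss_kernel) (use assms(5) \<open>\<delta> > 0\<close> in auto)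
  moreover have "\<forall>\<^sub>F t in at_right 0. \<forall>x. \<bar>(LINT z|lborel. gauss_kernel t x z * \<phi> z) - \<phi> x\<bar> \<le> e / 2"
    by (rule gauss_kernel_approximate_identity[OF assms(1,2,4)]) (use \<open>e > 0\<close> in auto)
  ultimately show "\<forall>\<^sub>F t in at_right 0. dist (LINT x:\<Omega>|lborel. image_kernel t x y * \<phi> x) (\<phi> y) < e"
    using eventually_at_right_less[of "0 :: real"]
  proof eventually_elim
    case (elim t)
    have "\<bar>(LINT x|lborel. image_kernel t x y * \<phi> x) - (LINT x|lborel. gauss_kernel t y x * \<phi> x)\<bar> \<le> \<delta> * I"
      unfolding I_def
      by (rule integral_image_kernel_near[OF assms(1,2,4)])
        (use elim assms(3) \<open>\<delta> > 0\<close> in \<open>auto simp: gauss_kernel_commute[of t y] intro!: continuous_on_image_kernel continuous_on_id continuous_on_const\<close>)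
    moreover have "\<bar>(LINT x|lborel. gauss_kernel t y x * \<phi> x) - \<phi> y\<bar> \<le> e / 2"
      using elim by blast
    moreover have "(LINT x:\<Omega>|lborel. image_kernel t x y * \<phi> x) = (LINT x|lborel. image_kernel t x y * \<phi> x)"
      by (rule set_integral_superset_support) (use assms(3,4) in auto)
    ultimately show ?case using \<open>\<delta> * I < e / 2\<close> unfolding dist_real_def by linarith
  qed
qed

text \<open>Two errors of at most \<delta> / 2 each: replacing the image kernel by the Gauss kernel,
  uniformly for \<open>z\<close> in the support, and smoothing with the Gauss kernel. Both are
  uniform in \<open>x\<close>.\<close>

lemma smoothed_initial:
  assumes "continuous_on UNIV f" "compact K" "K \<subseteq> \<Omega>" "\<And>x. x \<notin> K \<Longrightarrow> f x = 0" "\<Omega> \<subseteq> cbox a b" "\<delta> > 0"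
  shows "\<forall>\<^sub>F t in at_right 0. \<forall>x\<in>\<Omega>. \<bar>smoothed (\<lambda>t w. gauss_kernel t w 0) a b f t x - f x\<bar> \<le> \<delta>"
proof -
  define I where "I = (LINT x|lborel. \<bar>f x\<bar>)"
  have "I \<ge> 0" by (simp add: I_def)
  define e where "e = \<delta> / (2 * (I + 1))"
  have "e > 0" using \<open>\<delta> > 0\<close> \<open>I \<ge> 0\<close> by (simp add: e_def)
  have "e * I \<le> \<delta> / 2" using \<open>\<delta> > 0\<close> \<open>I \<ge> 0\<close> by (simp add: e_def field_simps)
  have "\<forall>\<^sub>F t in at_right 0. \<forall>x\<in>\<Omega>. \<forall>z\<in>K. \<bar>image_kernel t x z - gauss_kernel t x z\<bar> \<le> e"
    by (rule image_kernel_near_gauss_kernel[OF assms(2,3) \<open>e > 0\<close>])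
  moreover have "\<forall>\<^sub>F t in at_right 0. \<forall>x. \<bar>(LINT z|lborel. gauss_kernel t x z * f z) - f x\<bar> \<le> \<delta> / 2"
    by (rule gauss_kernel_approximate_identity[OF assms(1,2,4)]) (use \<open>\<delta> > 0\<close> in auto)
  ultimately show ?thesis
    using eventually_at_right_less[of "0 :: real"]
  proof eventually_elim
    case (elim t)
    show ?case
    proof
      fix x assume "x \<in> \<Omega>"
      have c: "continuous_on UNIV (\<lambda>z. image_kernel t x z)"
        using elim by (intro continuous_on_image_kernel continuous_on_id continuous_on_const)
      have "\<bar>(LINT z|lborel. image_kernel t x z * f z) - (LINT z|lborel. gauss_kernel t x z * f z)\<bar> \<le> e * I"
        unfolding I_def
        by (rule integral_image_kernel_near[OF assms(1,2,4) c]) (use elim \<open>x \<in> \<Omega>\<close> \<open>e > 0\<close> in auto)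
      moreover have "smoothed (\<lambda>t w. gauss_kernel t w 0) a b f t x = (LINT z|lborel. image_kernel t x z * f z)"
        unfolding smoothed_def image_kernel_def[symmetric]
        by (rule integral_cbox_superset_support[OF _ assms(2)])
          (use c assms in \<open>auto intro: continuous_on_mult continuous_on_subset\<close>)
      moreover have "\<bar>(LINT z|lborel. gauss_kernel t x z * f z) - f x\<bar> \<le> \<delta> / 2"
        using elim by blast
      ultimately show "\<bar>smoothed (\<lambda>t w. gauss_kernel t w 0) a b f t x - f x\<bar> \<le> \<delta>"
        using \<open>e * I \<le> \<delta> / 2\<close> by linarith
    qed
  qed
qed

text \<open>
  The solution with initial data \<open>q \<epsilon> z * \<phi> z\<close> (a cut-off of \<open>q \<epsilon>\<close>) and zero boundary values
  stays below \<open>q\<close> restarted at time \<open>\<epsilon>\<close>.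
\<close>

lemma smoothed_le_positive_solution:
  assumes q: "heat_solution \<Omega> q" "\<And>t x. t > 0 \<Longrightarrow> x \<in> \<Omega> \<Longrightarrow> 0 \<le> q t x"
    and \<phi>: "continuous_on UNIV \<phi>" "compact K" "K \<subseteq> \<Omega>" "\<And>x. x \<notin> K \<Longrightarrow> \<phi> x = 0" "\<And>x. 0 \<le> \<phi> x" "\<And>x. \<phi> x \<le> 1"
    and f: "\<And>z. f z = (if z \<in> \<Omega> then q \<epsilon> z * \<phi> z else 0)"
    and "\<epsilon> > 0" and box: "\<Omega> \<subseteq> cbox a b" and tx: "t > 0" "x \<in> \<Omega>"
  shows "continuous_on UNIV f" "smoothed (\<lambda>t w. gauss_kernel t w 0) a b f t x \<le> q (\<epsilon> + t) x"
proof -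
  have cq: "continuous_on ({0<..} \<times> \<Omega>) (\<lambda>(t, x). q t x)"
    using q(1) unfolding heat_solution_def by blast
  have "continuous_on \<Omega> (\<lambda>x. (\<epsilon>, x))"
    by (intro continuous_on_Pair continuous_on_const continuous_on_id)
  from continuous_on_compose2[OF cq this] have cqe: "continuous_on \<Omega> (q \<epsilon>)"
    using \<open>\<epsilon> > 0\<close> by auto
  \<comment> \<open>Values of \<open>q\<close> outside \<Omega> are arbitrary, so continuity is
    glued from two open sets: \<Omega>, and the complement of \<open>K\<close>, where
    \<open>f\<close> is zero.\<close>
  have "continuous_on (\<Omega> \<union> - K) f"
  proof (rule continuous_on_open_Un)
    show "open \<Omega>" by (rule open_domain)
    show "open (- K)" using \<phi>(2) by (simp add: compact_imp_closed open_Compl)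
    have "continuous_on \<Omega> (\<lambda>z. q \<epsilon> z * \<phi> z)"
      by (intro continuous_on_mult cqe continuous_on_subset[OF \<phi>(1)]) simp
    then show "continuous_on \<Omega> f" by (simp add: f cong: continuous_on_cong)
    have "continuous_on (- K) (\<lambda>z. 0 :: real)" by simp
    then show "continuous_on (- K) f"
      by (rule continuous_on_eq) (simp add: f \<phi>(4))
  qed
  moreover have "\<Omega> \<union> - K = UNIV" using \<phi>(3) by blast
  ultimately show cf: "continuous_on UNIV f" by simp
  have f0: "f z = 0" if "z \<notin> K" for z using \<phi>(4)[OF that] by (simp add: f)
  show "smoothed (\<lambda>t w. gauss_kernel t w 0) a b f t x \<le> q (\<epsilon> + t) x"
  proof (rule caloric_comparison[OF open_domain bounded_domain _ _ _ _ _ _ _ tx])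
    show "axiswise_caloric \<Omega> (\<lambda>t. q (\<epsilon> + t))"
      using \<open>\<epsilon> > 0\<close> by (intro axiswise_caloric_shift heat_solution_imp_axiswise_caloric q(1)) simp
    show "axiswise_caloric \<Omega> (smoothed (\<lambda>t w. gauss_kernel t w 0) a b f)"
      by (rule axiswise_caloric_smoothed[OF cf])
    show "continuous_on ({0<..} \<times> \<Omega>) (\<lambda>(t, x). q (\<epsilon> + t) x)"
    proof -
      have "continuous_on ({0<..} \<times> \<Omega>) (\<lambda>p. (\<epsilon> + fst p, snd p))"
        by (intro continuous_intros)
      moreover have "(\<lambda>p. (\<epsilon> + fst p, snd p)) ` ({0<..} \<times> \<Omega>) \<subseteq> {0<..} \<times> \<Omega>"
        using \<open>\<epsilon> > 0\<close> by auto
      ultimately show ?thesis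
        using continuous_on_compose2[OF cq, of "{0<..} \<times> \<Omega>" "\<lambda>p. (\<epsilon> + fst p, snd p)"]
        by (simp add: case_prod_unfold)
    qed
    show "continuous_on ({0<..} \<times> closure \<Omega>) (\<lambda>(t, x). smoothed (\<lambda>t w. gauss_kernel t w 0) a b f t x)"
      by (rule continuous_on_subset[OF continuous_on_smoothed[OF gaussian_decay_gauss_kernel cf]]) auto
    show "0 \<le> q (\<epsilon> + t) x" if "t > 0" "x \<in> \<Omega>" for t x using that q(2) \<open>\<epsilon> > 0\<close> by simp
    show "smoothed (\<lambda>t w. gauss_kernel t w 0) a b f t x \<le> 0" if "t > 0" "x \<in> frontier \<Omega>" for t x
      using image_kernel_frontier[OF that(2,1)]
      by (simp add: smoothed_def image_kernel_def)
    fix \<delta> :: real assume "\<delta> > 0"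
    \<comment> \<open>Over \<open>K\<close> the data exceed \<open>q\<close> at time \<epsilon> + t
      by at most \<delta> / 2 for all small t at once, by uniform continuity on a compact slab of
      duration 1. Off \<open>K\<close> the data are 0 and positivity of \<open>q\<close>
      suffices.\<close>
    have "uniformly_continuous_on ({\<epsilon>..\<epsilon> + 1} \<times> K) (\<lambda>(t, x). q t x)"
      using \<phi>(2,3) \<open>\<epsilon> > 0\<close>
      by (intro compact_uniformly_continuous continuous_on_subset[OF cq] compact_Times) auto
    then obtain d where "d > 0" and d: "\<And>p p'. p \<in> {\<epsilon>..\<epsilon> + 1} \<times> K \<Longrightarrow> p' \<in> {\<epsilon>..\<epsilon> + 1} \<times> K \<Longrightarrow>
        dist p' p < d \<Longrightarrow> dist (case p' of (t, x) \<Rightarrow> q t x) (case p of (t, x) \<Rightarrow> q t x) < \<delta> / 2"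
      unfolding uniformly_continuous_on_def using \<open>\<delta> > 0\<close> half_gt_zero by metis
    have "\<forall>\<^sub>F t in at_right 0. \<forall>x\<in>\<Omega>. \<bar>smoothed (\<lambda>t w. gauss_kernel t w 0) a b f t x - f x\<bar> \<le> \<delta> / 2"
      by (rule smoothed_initial[OF cf \<phi>(2,3) f0 box]) (use \<open>\<delta> > 0\<close> in auto)
    moreover have "\<forall>\<^sub>F t in at_right 0. t \<in> {0<..<min d 1}"
      by (rule eventually_at_right_real) (use \<open>d > 0\<close> in simp)
    ultimately show "\<forall>\<^sub>F t in at_right 0. \<forall>x\<in>\<Omega>. smoothed (\<lambda>t w. gauss_kernel t w 0) a b f t x \<le> q (\<epsilon> + t) x + \<delta>"
    proof eventually_elim
      case (elim t)
      show ?case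
      proof
        fix x assume "x \<in> \<Omega>"
        have "f x \<le> q (\<epsilon> + t) x + \<delta> / 2"
        proof (cases "x \<in> K")
          case True
          have "f x \<le> q \<epsilon> x"
            using \<open>x \<in> \<Omega>\<close> q(2)[OF \<open>\<epsilon> > 0\<close> \<open>x \<in> \<Omega>\<close>] \<phi>(6)[of x] by (simp add: f mult_left_le)
          moreover have "dist (q \<epsilon> x) (q (\<epsilon> + t) x) < \<delta> / 2"
            using d[of "(\<epsilon> + t, x)" "(\<epsilon>, x)"] True elim by (simp add: dist_Pair_Pair dist_real_def)
          ultimately show ?thesis unfolding dist_real_def by linarith
        next
          case False
          have "q (\<epsilon> + t) x \<ge> 0" using q(2) \<open>\<epsilon> > 0\<close> elim \<open>x \<in> \<Omega>\<close> by simp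
          with f0[OF False] \<open>\<delta> > 0\<close> show ?thesis by simp
        qed
        moreover have "\<bar>smoothed (\<lambda>t w. gauss_kernel t w 0) a b f t x - f x\<bar> \<le> \<delta> / 2"
          using elim \<open>x \<in> \<Omega>\<close> by blast
        ultimately show "smoothed (\<lambda>t w. gauss_kernel t w 0) a b f t x \<le> q (\<epsilon> + t) x + \<delta>" by linarith
      qed
    qed
  qed
qed

lemma image_kernel_minimal:
  assumes q: "positive_fundamental_solution \<Omega> y q" and "y \<in> \<Omega>" "t > 0" "x \<in> \<Omega>"
  shows "image_kernel t x y \<le> q t x"
proof -
  have heat: "heat_solution \<Omega> q" and pos: "\<And>t x. t > 0 \<Longrightarrow> x \<in> \<Omega> \<Longrightarrow> 0 \<le> q t x"
    and init: "\<And>\<phi> K. continuous_on UNIV \<phi> \<Longrightarrow> compact K \<Longrightarrow> K \<subseteq> \<Omega> \<Longrightarrow> (\<And>x. x \<notin> K \<Longrightarrow> \<phi> x = 0) \<Longrightarrow>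
      ((\<lambda>t. LINT x:\<Omega>|lborel. q t x * \<phi> x) \<longlongrightarrow> \<phi> y) (at_right 0)"
    using q unfolding positive_fundamental_solution_def by blast+
  obtain r where "r > 0" and r: "cball y r \<subseteq> \<Omega>"
    using open_domain \<open>y \<in> \<Omega>\<close> open_contains_cball by blast
  \<comment> \<open>A tent of height 1 at \<open>y\<close>, supported in a closed ball inside
    \<Omega>.\<close>
  define \<phi> where "\<phi> z = max 0 (1 - dist z y / r)" for z
  have \<phi>: "continuous_on UNIV \<phi>" "\<And>z. z \<notin> cball y r \<Longrightarrow> \<phi> z = 0" "\<And>z. 0 \<le> \<phi> z" "\<And>z. \<phi> z \<le> 1" "\<phi> y = 1"
    using \<open>r > 0\<close> unfolding \<phi>_def by (auto intro!: continuous_intros simp: dist_commute)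
  obtain a b where box: "\<Omega> \<subseteq> cbox a b"
    using bounded_subset_cbox_symmetric[OF bounded_domain] by blast
  have cP: "continuous_on S (\<lambda>z. image_kernel t x z)" for S
    by (intro continuous_on_image_kernel \<open>t > 0\<close> continuous_on_id continuous_on_const)
  \<comment> \<open>With t and x fixed, the kernel as a function of \<open>z\<close> times \<phi> is
    itself a continuous test function of compact support, so the initial condition of
    \<open>q\<close> applies to it.\<close>
  have L1: "((\<lambda>\<epsilon>. LINT z:\<Omega>|lborel. q \<epsilon> z * (image_kernel t x z * \<phi> z)) \<longlongrightarrow> image_kernel t x y * \<phi> y) (at_right 0)"
    by (rule init[OF _ compact_cball r]) (use \<phi>(1,2) cP in \<open>auto intro: continuous_on_mult\<close>)
  have L2: "((\<lambda>\<epsilon>. q (\<epsilon> + t) x) \<longlongrightarrow> q t x) (at_right 0)"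
  proof -
    obtain D where "((\<lambda>s. q s x) has_real_derivative D) (at t)"
      using heat \<open>t > 0\<close> \<open>x \<in> \<Omega>\<close> unfolding heat_solution_def by blast
    then have "isCont (\<lambda>s. q s x) t" by (rule DERIV_isCont)
    moreover have "((\<lambda>\<epsilon>. \<epsilon> + t) \<longlongrightarrow> t) (at_right 0)" by (auto intro!: tendsto_eq_intros)
    ultimately show ?thesis by (rule isCont_tendsto_compose)
  qed
  have "\<forall>\<^sub>F \<epsilon> in at_right 0. (LINT z:\<Omega>|lborel. q \<epsilon> z * (image_kernel t x z * \<phi> z)) \<le> q (\<epsilon> + t) x"
    using eventually_at_right_less[of "0 :: real"]
  proof eventually_elim
    case (elim \<epsilon>)
    define f where "f z = (if z \<in> \<Omega> then q \<epsilon> z * \<phi> z else 0)" for z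
    note le = smoothed_le_positive_solution[OF heat pos \<phi>(1) compact_cball r \<phi>(2-4) f_def elim box \<open>t > 0\<close> \<open>x \<in> \<Omega>\<close>]
    have "smoothed (\<lambda>t w. gauss_kernel t w 0) a b f t x = (LINT z|lborel. image_kernel t x z * f z)"
      unfolding smoothed_def image_kernel_def[symmetric]
    proof (rule integral_cbox_superset_support[OF _ compact_cball])
      show "continuous_on (cball y r) (\<lambda>z. image_kernel t x z * f z)"
        by (intro continuous_on_mult cP continuous_on_subset[OF le(1) subset_UNIV])
      show "image_kernel t x z * f z = 0" if "z \<notin> cball y r" for z
        using \<phi>(2)[OF that] by (simp add: f_def)
      show "cball y r \<subseteq> cbox a b" using r box by blast
    qed
    also have "\<dots> = (LINT z:\<Omega>|lborel. q \<epsilon> z * (image_kernel t x z * \<phi> z))"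
      by (rule set_integral_superset_support[symmetric]) (auto simp: f_def)
    finally show ?case using le(2) by (simp add: add.commute)
  qed
  then have "image_kernel t x y * \<phi> y \<le> q t x"
    by (rule tendsto_le[OF trivial_limit_at_right_real L2 L1])
  then show ?thesis by (simp add: \<phi>(5))
qed

theorem is_heat_kernel_image_kernel: "is_heat_kernel \<Omega> image_kernel"
  unfolding is_heat_kernel_def
proof (intro ballI conjI allI impI)
  fix y assume "y \<in> \<Omega>"
  then show "positive_fundamental_solution \<Omega> y (\<lambda>t x. image_kernel t x y)"
    unfolding positive_fundamental_solution_def
    by (intro conjI allI impI ballI heat_solution_image_kernel image_kernel_nonneg)
      (auto intro: image_kernel_initial)
qed (rule image_kernel_minimal)

end

section \<open>The reflection group of an equilateral triangle\<close>

definition equilateral :: "real \<Rightarrow> real^2 \<Rightarrow> real^2 \<Rightarrow> real^2 \<Rightarrow> bool" where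
  "equilateral L A B C \<longleftrightarrow> L > 0 \<and> dist A B = L \<and> dist B C = L \<and> dist C A = L"

lemma equilateral_rotate: "equilateral L A B C \<Longrightarrow> equilateral L B C A"
  by (simp add: equilateral_def)

text \<open>The barycentric coordinate belonging to \<open>A\<close>: it vanishes on the line through \<open>B\<close> and \<open>C\<close>.\<close>

definition bary :: "real \<Rightarrow> real^2 \<Rightarrow> real^2 \<Rightarrow> real^2 \<Rightarrow> real^2 \<Rightarrow> real" where
  "bary L A B C x = 2 / (3 * L\<^sup>2) * ((x - B) \<bullet> (2 *\<^sub>R A - B - C))"

lemma equilateral_inner:
  assumes "equilateral L A B C"
  shows "(A - B) \<bullet> (A - B) = L\<^sup>2" "(C - B) \<bullet> (C - B) = L\<^sup>2" "(A - B) \<bullet> (C - B) = L\<^sup>2 / 2"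
proof -
  have d: "(A - B) \<bullet> (A - B) = L\<^sup>2" "(C - B) \<bullet> (C - B) = L\<^sup>2" "(C - A) \<bullet> (C - A) = L\<^sup>2"
    using assms by (auto simp: equilateral_def dist_norm norm_minus_commute power2_norm_eq_inner[symmetric])
  then show "(A - B) \<bullet> (A - B) = L\<^sup>2" "(C - B) \<bullet> (C - B) = L\<^sup>2" by auto
  have "(C - A) \<bullet> (C - A) = (C - B) \<bullet> (C - B) + (A - B) \<bullet> (A - B) - 2 * ((A - B) \<bullet> (C - B))"
    by (simp add: inner_diff_left inner_diff_right inner_commute)
  with d show "(A - B) \<bullet> (C - B) = L\<^sup>2 / 2" by simp
qed

text \<open>2 A - B - C is twice the altitude vector from the midpoint of the opposite side to
  \<open>A\<close>, hence normal to that side. Its product with A - B explains the factor in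
  \<open>bary\<close>, which makes the coordinate equal to 1 at \<open>A\<close>.\<close>

lemma equilateral_normal:
  assumes "equilateral L A B C"
  shows "(A - B) \<bullet> (2 *\<^sub>R A - B - C) = 3 * L\<^sup>2 / 2" "(C - B) \<bullet> (2 *\<^sub>R A - B - C) = 0"
    "(2 *\<^sub>R A - B - C) \<bullet> (2 *\<^sub>R A - B - C) = 3 * L\<^sup>2"
proof -
  have N: "2 *\<^sub>R A - B - C = 2 *\<^sub>R (A - B) - (C - B)" by (simp add: scaleR_2)
  note I = equilateral_inner[OF assms]
  show "(A - B) \<bullet> (2 *\<^sub>R A - B - C) = 3 * L\<^sup>2 / 2"
    unfolding N inner_diff_right[of _ "2 *\<^sub>R (A - B)"] inner_scaleR_right I by simp
  show "(C - B) \<bullet> (2 *\<^sub>R A - B - C) = 0"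
    unfolding N inner_diff_right[of _ "2 *\<^sub>R (A - B)"] inner_scaleR_right inner_commute[of "C - B" "A - B"] I by simp
  show "(2 *\<^sub>R A - B - C) \<bullet> (2 *\<^sub>R A - B - C) = 3 * L\<^sup>2"
    unfolding N inner_diff_right[of _ "2 *\<^sub>R (A - B)"] inner_diff_left[of "2 *\<^sub>R (A - B)"]
      inner_scaleR_right inner_scaleR_left inner_commute[of "C - B" "A - B"] I by simp
qed

lemma bary_combination:
  assumes "equilateral L A B C" "a + b + c = 1"
  shows "bary L A B C (a *\<^sub>R A + b *\<^sub>R B + c *\<^sub>R C) = a"
proof -
  have b: "b = 1 - a - c" using assms(2) by simp
  have "a *\<^sub>R A + b *\<^sub>R B + c *\<^sub>R C - B = a *\<^sub>R (A - B) + c *\<^sub>R (C - B)"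
    unfolding b by (simp add: algebra_simps)
  then have "bary L A B C (a *\<^sub>R A + b *\<^sub>R B + c *\<^sub>R C) = 2 / (3 * L\<^sup>2) * (a * (3 * L\<^sup>2 / 2))"
    unfolding bary_def
    by (simp only: inner_add_left inner_scaleR_left equilateral_normal[OF assms(1)]) simp
  then show ?thesis using assms(1) by (simp add: equilateral_def)
qed

lemma bary_combinations:
  assumes "equilateral L A B C" "a + b + c = 1" "x = a *\<^sub>R A + b *\<^sub>R B + c *\<^sub>R C"
  shows "bary L A B C x = a" "bary L B C A x = b" "bary L C A B x = c"
proof -
  have e: "equilateral L B C A" "equilateral L C A B" using assms(1) equilateral_rotate by blast+
  show "bary L A B C x = a" using bary_combination assms by simp
  show "bary L B C A x = b"
    using bary_combination[OF e(1), of b c a] assms(2,3) by (simp add: algebra_simps)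
  show "bary L C A B x = c"
    using bary_combination[OF e(2), of c a b] assms(2,3) by (simp add: algebra_simps)
qed

lemma equilateral_not_collinear:
  assumes "equilateral L A B C"
  shows "\<not> collinear {A, B, C}"
proof
  assume "collinear {A, B, C}"
  then have "collinear {0, A - B, C - B}" by (simp add: collinear_3)
  moreover have "L > 0" using assms by (simp add: equilateral_def)
  then have "A - B \<noteq> 0" "C - B \<noteq> 0" using equilateral_inner[OF assms] by auto
  ultimately obtain c where c: "C - B = c *\<^sub>R (A - B)" using collinear_lemma by blast
  then have "c * L\<^sup>2 = L\<^sup>2 / 2" "c * (c * L\<^sup>2) = L\<^sup>2"
    using equilateral_inner[OF assms] by (simp_all only: inner_scaleR_left inner_scaleR_right)
  with \<open>L > 0\<close> have "c = 1 / 2" "c * c = 1" by (auto simp: field_simps)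
  from this(2) show False unfolding \<open>c = 1 / 2\<close> by simp
qed

text \<open>Three non-collinear points span the plane affinely, so some weights of sum 1 exist;
  \<open>bary_combinations\<close> identifies them.\<close>

lemma equilateral_decomposition:
  assumes "equilateral L A B C"
  shows "bary L A B C x + bary L B C A x + bary L C A B x = 1"
    and "x = bary L A B C x *\<^sub>R A + bary L B C A x *\<^sub>R B + bary L C A B x *\<^sub>R C"
proof -
  have "A \<noteq> B" "B \<noteq> C" "A \<noteq> C" "\<not> affine_dependent {A, B, C}"
    using equilateral_not_collinear[OF assms] by (auto simp: collinear_3_eq_affine_dependent)
  then have "affine hull {A, B, C} = UNIV"
    by (intro affine_independent_span_eq) auto
  then have "x \<in> affine hull {A, B, C}" by simp
  then obtain a b c where "a + b + c = 1" "x = a *\<^sub>R A + b *\<^sub>R B + c *\<^sub>R C"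
    unfolding affine_hull_3 by blast
  with bary_combinations[OF assms this]
  show "bary L A B C x + bary L B C A x + bary L C A B x = 1"
    and "x = bary L A B C x *\<^sub>R A + bary L B C A x *\<^sub>R B + bary L C A B x *\<^sub>R C" by simp_all
qed

lemma reflection_side:
  assumes "equilateral L A B C"
  shows "reflection (affine hull {B, C}) x = x - bary L A B C x *\<^sub>R (2 *\<^sub>R A - B - C)"
proof -
  define a b c where "a = bary L A B C x" and "b = bary L B C A x" and "c = bary L C A B x"
  have sum: "a + b + c = 1" and x: "x = a *\<^sub>R A + b *\<^sub>R B + c *\<^sub>R C"
    unfolding a_def b_def c_def using equilateral_decomposition[OF assms] by blast+
  \<comment> \<open>The orthogonal projection to the side. The coefficient is a / 2 because the
    normal vector is twice the altitude.\<close>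
  define foot where "foot = x - (a / 2) *\<^sub>R (2 *\<^sub>R A - B - C)"
  have foot: "foot = (b + a / 2) *\<^sub>R B + (c + a / 2) *\<^sub>R C"
    unfolding foot_def x by (simp add: algebra_simps)
  have "foot = closest_point (affine hull {B, C}) x"
  proof (rule closest_point_unique)
    have "(b + a / 2) + (c + a / 2) = 1" using sum by simp
    then show "foot \<in> affine hull {B, C}" unfolding affine_hull_2 foot by blast
    show "\<forall>z\<in>affine hull {B, C}. dist x foot \<le> dist x z"
    proof
      fix z assume "z \<in> affine hull {B, C}"
      then obtain u v where z: "z = u *\<^sub>R B + v *\<^sub>R C" "u + v = 1" unfolding affine_hull_2 by blast
      define k where "k = c + a / 2 - v"
      have "b + a / 2 - u = - k" using sum z(2) by (simp add: k_def)
      then have "foot - z = k *\<^sub>R (C - B)"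
        unfolding foot z(1) k_def by (simp add: algebra_simps flip: scaleR_add_left)
      then have "(x - foot) \<bullet> (foot - z) = 0"
        using equilateral_normal(2)[OF assms] by (simp add: foot_def inner_commute)
      then have "(norm (x - foot + (foot - z)))\<^sup>2 = (norm (x - foot))\<^sup>2 + (norm (foot - z))\<^sup>2"
        by (intro norm_add_Pythagorean) (simp add: orthogonal_def)
      then have "(norm (x - foot))\<^sup>2 \<le> (norm (x - z))\<^sup>2" by simp
      then show "dist x foot \<le> dist x z" by (simp add: dist_norm)
    qed
  qed (simp_all add: affine_imp_convex closed_affine_hull)
  then have "reflection (affine hull {B, C}) x = 2 *\<^sub>R foot - x" by (simp add: reflection_def)
  also have "\<dots> = x - a *\<^sub>R (2 *\<^sub>R A - B - C)"
    unfolding foot_def scaleR_diff_right[of 2 x] by (simp add: scaleR_2[of x])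
  finally show ?thesis by (simp add: a_def)
qed

lemma bary_reflection:
  assumes "equilateral L A B C" "y = reflection (affine hull {B, C}) x"
  shows "bary L A B C y = - bary L A B C x" "bary L B C A y = bary L B C A x + bary L A B C x"
    "bary L C A B y = bary L C A B x + bary L A B C x"
proof -
  define a b c where "a = bary L A B C x" and "b = bary L B C A x" and "c = bary L C A B x"
  have sum: "a + b + c = 1" and x: "x = a *\<^sub>R A + b *\<^sub>R B + c *\<^sub>R C"
    unfolding a_def b_def c_def using equilateral_decomposition[OF assms(1)] by blast+
  have "y = x - a *\<^sub>R (2 *\<^sub>R A - B - C)" using assms reflection_side by (simp add: a_def)
  also have "\<dots> = (- a) *\<^sub>R A + (b + a) *\<^sub>R B + (c + a) *\<^sub>R C"
    unfolding x by (simp add: algebra_simps scaleR_2)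
  finally show "bary L A B C y = - bary L A B C x" "bary L B C A y = bary L B C A x + bary L A B C x"
      "bary L C A B y = bary L C A B x + bary L A B C x"
    using bary_combinations[OF assms(1), of "- a" "b + a" "c + a" y] sum by (simp_all flip: a_def b_def c_def)
qed

lemma reflection_side_fixed:
  assumes "equilateral L A B C" "bary L A B C x = 0"
  shows "reflection (affine hull {B, C}) x = x"
  by (simp add: reflection_side[OF assms(1)] assms(2))

lemma reflection_side_involution:
  assumes "equilateral L A B C"
  shows "reflection (affine hull {B, C}) (reflection (affine hull {B, C}) x) = x"
  using bary_reflection(1)[OF assms refl, of x] by (simp add: reflection_side[OF assms])

text \<open>The linear part sends d to d - k N with k = 2 (d, N) / (N, N), a Householder reflection:
  the constant 2 / (3 L^2) is 2 / |N|^2.\<close>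

lemma reflection_side_isometry:
  assumes "equilateral L A B C"
  shows "dist (reflection (affine hull {B, C}) x) (reflection (affine hull {B, C}) y) = dist x y"
proof -
  define N where "N = 2 *\<^sub>R A - B - C"
  define d where "d = x - y"
  define k where "k = 2 / (3 * L\<^sup>2) * (d \<bullet> N)"
  have "L > 0" using assms by (simp add: equilateral_def)
  have NN: "N \<bullet> N = 3 * L\<^sup>2" unfolding N_def by (rule equilateral_normal(3)[OF assms])
  have "(x - B) \<bullet> N - (y - B) \<bullet> N = d \<bullet> N" by (simp add: inner_diff_left d_def)
  then have "bary L A B C x - bary L A B C y = k"
    unfolding bary_def N_def[symmetric] k_def right_diff_distrib[symmetric] by simp
  then have "reflection (affine hull {B, C}) x - reflection (affine hull {B, C}) y = d - k *\<^sub>R N"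
    by (simp add: reflection_side[OF assms] d_def N_def[symmetric]) (simp add: algebra_simps flip: scaleR_diff_left)
  moreover have "(d - k *\<^sub>R N) \<bullet> (d - k *\<^sub>R N) = d \<bullet> d - k * (2 * (d \<bullet> N) - k * (N \<bullet> N))"
    by (simp add: inner_diff_left inner_diff_right inner_commute algebra_simps)
  moreover have "2 * (d \<bullet> N) - k * (N \<bullet> N) = 0" using \<open>L > 0\<close> by (simp add: NN k_def)
  ultimately show ?thesis
    by (simp add: dist_norm norm_eq_sqrt_inner d_def)
qed

text \<open>
  In the coordinates \<open>u\<^sub>1, u\<^sub>2, u\<^sub>3\<close> with sum \<open>0\<close> for which the barycentric coordinates are
  \<open>u\<^sub>1 - u\<^sub>2\<close>, \<open>u\<^sub>2 - u\<^sub>3\<close> and \<open>u\<^sub>3 - u\<^sub>1 + 1\<close>, the reflection group acts as the affine symmetric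
  group: by permutations combined with integral translations of sum \<open>0\<close>.
\<close>

definition alcove_coord :: "real \<Rightarrow> real^2 \<Rightarrow> real^2 \<Rightarrow> real^2 \<Rightarrow> real^2 \<Rightarrow> real^3" where
  "alcove_coord L A B C x =
    (let a = bary L A B C x; c = bary L C A B x; u = (a + 1 - c) / 3 in vector [u, u - a, u - 1 + c])"

section \<open>Alcove coordinates and the affine symmetric group\<close>

locale equilateral_triangle =
  fixes L :: real and A B C :: "real^2"
  assumes equilateral: "equilateral L A B C"
begin

abbreviation "u \<equiv> alcove_coord L A B C"

lemma equilateral_rotated: "equilateral L B C A" "equilateral L C A B"
  using equilateral equilateral_rotate by blast+

text \<open>The first coordinate (a + 1 - c) / 3 is the one for which the three sum to 0. The offset
  1 in the last identity makes the side through \<open>A\<close> and \<open>B\<close> the affine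
  wall u_1 - u_3 = 1.\<close>

lemma bary_alcove_coord:
  "bary L A B C x = u x $ 1 - u x $ 2" "bary L B C A x = u x $ 2 - u x $ 3"
  "bary L C A B x = u x $ 3 - u x $ 1 + 1"
  using equilateral_decomposition(1)[OF equilateral, of x]
  by (simp_all add: alcove_coord_def Let_def)

lemma alcove_coord_inject:
  assumes "u x = u y"
  shows "x = y"
  using equilateral_decomposition(2)[OF equilateral, of x]
    equilateral_decomposition(2)[OF equilateral, of y] assms
  by (simp add: bary_alcove_coord)

text \<open>\<open>p\<close> encodes the linear part and \<open>k\<close> the translation, whose sum
  0 preserves the plane of coordinate sum 0. Since \<open>p\<close> acts on indices, composing maps
  composes the permutations in the opposite order.\<close>

definition alcove_action :: "(real^2 \<Rightarrow> real^2) \<Rightarrow> (3 \<Rightarrow> 3) \<Rightarrow> (3 \<Rightarrow> int) \<Rightarrow> bool" where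
  "alcove_action g p k \<longleftrightarrow> p permutes UNIV \<and> (\<Sum>i\<in>UNIV. k i) = 0 \<and>
    (\<forall>x i. u (g x) $ i = u x $ p i + of_int (k i))"

lemma alcove_action_reflection:
  assumes "\<rho> \<in> side_reflections A B C"
  shows "\<exists>i j k. i \<noteq> j \<and> alcove_action \<rho> (Transposition.transpose i j) k"
proof -
  have n: "(1::3) \<noteq> 2" "(2::3) \<noteq> 3" "(1::3) \<noteq> 3" "(2::3) \<noteq> 1" "(3::3) \<noteq> 2" "(3::3) \<noteq> 1" by auto
  consider "\<rho> = reflection (affine hull {A, B})" | "\<rho> = reflection (affine hull {B, C})"
    | "\<rho> = reflection (affine hull {C, A})" using assms unfolding side_reflections_def by blast
  then show ?thesis
  proof cases
    case 1
    \<comment> \<open>The reflection in the affine wall u_1 - u_3 = 1 is the only one of the three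
      with a translation part, (1, 0, -1).\<close>
    have "u (\<rho> x) $ 1 = u x $ 3 + 1 \<and> u (\<rho> x) $ 2 = u x $ 2 \<and> u (\<rho> x) $ 3 = u x $ 1 - 1" for x
      unfolding alcove_coord_def Let_def vector_3 1
      using bary_reflection[OF equilateral_rotated(2) refl, of x] equilateral_decomposition(1)[OF equilateral, of x]
      by (auto simp: field_simps)
    then have "alcove_action \<rho> (Transposition.transpose 1 3) (\<lambda>i. if i = 1 then 1 else if i = 3 then -1 else 0)"
      using n by (simp add: alcove_action_def permutes_swap_id sum_3 forall_3 transpose_def)
    with n show ?thesis by blast
  next
    case 2
    have "u (\<rho> x) $ 1 = u x $ 2 \<and> u (\<rho> x) $ 2 = u x $ 1 \<and> u (\<rho> x) $ 3 = u x $ 3" for x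
      unfolding alcove_coord_def Let_def vector_3 2
      using bary_reflection[OF equilateral refl, of x] equilateral_decomposition(1)[OF equilateral, of x]
      by (auto simp: field_simps)
    then have "alcove_action \<rho> (Transposition.transpose 1 2) (\<lambda>i. 0)"
      using n by (simp add: alcove_action_def permutes_swap_id sum_3 forall_3 transpose_def)
    with n show ?thesis by blast
  next
    case 3
    have "u (\<rho> x) $ 1 = u x $ 1 \<and> u (\<rho> x) $ 2 = u x $ 3 \<and> u (\<rho> x) $ 3 = u x $ 2" for x
      unfolding alcove_coord_def Let_def vector_3 3
      using bary_reflection[OF equilateral_rotated(1) refl, of x] equilateral_decomposition(1)[OF equilateral, of x]
      by (auto simp: field_simps)
    then have "alcove_action \<rho> (Transposition.transpose 2 3) (\<lambda>i. 0)"
      using n by (simp add: alcove_action_def permutes_swap_id sum_3 forall_3 transpose_def)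
    with n show ?thesis by blast
  qed
qed

text \<open>Each letter contributes one transposition, so the parity of the word can be read off
  \<open>p\<close>. It becomes an invariant of the map once \<open>p\<close> is known to be
  unique.\<close>

lemma alcove_action_word:
  assumes "w \<in> lists (side_reflections A B C)"
  shows "\<exists>p k. alcove_action (compose_word w) p k \<and> sign p = (-1) ^ length w"
  using assms
proof (induction w)
  case Nil
  have "alcove_action (compose_word []) id (\<lambda>_. 0)"
    by (simp add: alcove_action_def compose_word_def permutes_id)
  then show ?case by (metis list.size(3) power_0 sign_id)
next
  case (Cons \<rho> w)
  then obtain p k where g: "alcove_action (compose_word w) p k" and "sign p = (-1) ^ length w" by blast
  obtain i j l where "i \<noteq> j" and \<rho>: "alcove_action \<rho> (Transposition.transpose i j) l"
    using alcove_action_reflection Cons.hyps(1) by blast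
  have perm: "Transposition.transpose i j permutes UNIV" "p permutes UNIV"
    using g \<rho> by (auto simp: alcove_action_def)
  have "alcove_action (compose_word (\<rho> # w)) (p \<circ> Transposition.transpose i j) (\<lambda>m. k (Transposition.transpose i j m) + l m)"
    using g \<rho> sum.permute[OF perm(1), of k] permutes_compose[OF perm]
    by (simp add: alcove_action_def compose_word_def sum.distrib comp_def)
  moreover have "sign (p \<circ> Transposition.transpose i j) = (-1) ^ length (\<rho> # w)"
    using perm \<open>i \<noteq> j\<close> \<open>sign p = _\<close>
    by (subst sign_compose) (auto simp: permutation_permutes sign_swap_id intro: exI[of _ UNIV])
  ultimately show ?case by blast
qed

section \<open>The triangle as a fundamental domain\<close>

definition alcove :: "(real^2) set" where
  "alcove = {x. 0 < bary L A B C x \<and> 0 < bary L B C A x \<and> 0 < bary L C A B x}"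

text \<open>In alcove coordinates the triangle is u_3 < u_2 < u_1 < u_3 + 1. Differences of
  coordinates are less than 1 in modulus, which leaves no room for a nonzero integral translation of
  sum 0; then \<open>p\<close> preserves a strict order and is the identity.\<close>

lemma alcove_action_rigid:
  assumes "x \<in> alcove" "y \<in> alcove" "p permutes UNIV" "(\<Sum>i\<in>UNIV. k i) = 0"
    and eq: "\<And>i. u y $ i = u x $ p i + of_int (k i)"
  shows "p i = i" "k i = 0"
proof -
  have x: "u x $ 2 < u x $ 1" "u x $ 3 < u x $ 2" "u x $ 1 < u x $ 3 + 1"
    and y: "u y $ 2 < u y $ 1" "u y $ 3 < u y $ 2" "u y $ 1 < u y $ 3 + 1"
    using assms(1,2) by (auto simp: alcove_def bary_alcove_coord)
  have range: "u x $ i - u x $ j < 1" for i j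
    using exhaust_3[of i] exhaust_3[of j] x by auto
  have lt: "0 \<le> k i - k j \<and> k i - k j \<le> 1" if "u y $ j < u y $ i" "u y $ i < u y $ j + 1" for i j
  proof -
    have "of_int (k i - k j) = (u y $ i - u y $ j) - (u x $ p i - u x $ p j)" by (simp add: eq)
    moreover have "u x $ p i - u x $ p j < 1" "u x $ p j - u x $ p i < 1" by (rule range)+
    ultimately have "-1 < real_of_int (k i - k j)" "real_of_int (k i - k j) < 2" using that by linarith+
    then show ?thesis by linarith
  qed
  \<comment> \<open>\<open>k\<close> is weakly decreasing and drops by at most 1 in all, so its sum
    is 3 * k 3 plus 0, 1 or 2. As the sum is 0, all entries vanish.\<close>
  have "k 1 + k 2 + k 3 = 0" using assms(4) by (simp add: sum_3)
  moreover have "0 \<le> k 1 - k 2 \<and> k 1 - k 2 \<le> 1" using y by (intro lt) auto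
  moreover have "0 \<le> k 2 - k 3 \<and> k 2 - k 3 \<le> 1" using y by (intro lt) auto
  moreover have "0 \<le> k 1 - k 3 \<and> k 1 - k 3 \<le> 1" using y by (intro lt) auto
  ultimately have k: "k 1 = 0" "k 2 = 0" "k 3 = 0" by presburger+
  then show "k i = 0" using exhaust_3[of i] by auto
  have "u x $ p 2 < u x $ p 1" "u x $ p 3 < u x $ p 2" using y k by (simp_all add: eq)
  then have "p 1 = 1 \<and> p 2 = 2 \<and> p 3 = 3"
    using exhaust_3[of "p 1"] exhaust_3[of "p 2"] exhaust_3[of "p 3"] x by auto
  then show "p i = i" using exhaust_3[of i] by auto
qed

text \<open>Rigidity applied to h^-1 g, which takes \<open>x\<close> to \<open>y\<close> and whose
  permutation is \<open>p\<close> composed with the inverse of \<open>p'\<close>. For g = h it says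
  that the map determines its permutation; for different g and h it rules out overlapping images of
  the alcove.\<close>

lemma alcove_action_unique:
  assumes "alcove_action g p k" "alcove_action h p' k'" "x \<in> alcove" "y \<in> alcove" "g x = h y"
  shows "p = p'" "g = h"
proof -
  have p': "p' permutes UNIV" using assms(2) by (simp add: alcove_action_def)
  let ?q = "inv p'"
  have q: "?q permutes UNIV" by (rule permutes_inv[OF p'])
  have pq: "p' (?q i) = i" for i by (rule permutes_inverses(1)[OF p'])
  have qp: "?q (p' i) = i" for i by (rule permutes_inverses(2)[OF p'])
  have "p \<circ> ?q permutes UNIV"
    using permutes_compose[OF q] assms(1) by (simp add: alcove_action_def)
  moreover have "(\<Sum>i\<in>UNIV. k (?q i) - k' (?q i)) = 0"
    using sum.permute[OF q, of k] sum.permute[OF q, of k'] assms(1,2)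
    by (simp add: alcove_action_def sum_subtractf comp_def)
  moreover have "u y $ i = u x $ (p \<circ> ?q) i + of_int (k (?q i) - k' (?q i))" for i
  proof -
    have "u (g x) $ ?q i = u x $ p (?q i) + of_int (k (?q i))" using assms(1) by (simp add: alcove_action_def)
    moreover have "u (h y) $ ?q i = u y $ i + of_int (k' (?q i))" using assms(2) by (simp add: alcove_action_def pq)
    ultimately show ?thesis using assms(5) by simp
  qed
  ultimately have "(p \<circ> ?q) i = i" "k (?q i) - k' (?q i) = 0" for i
    using alcove_action_rigid[OF assms(3,4), of "p \<circ> ?q" "\<lambda>i. k (?q i) - k' (?q i)"] by blast+
  from this[of "p' _"] have eq: "p i = p' i" "k i = k' i" for i by (simp_all add: qp)
  then show "p = p'" by blast
  have "u (g z) = u (h z)" for z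
    using assms(1,2) eq by (simp add: alcove_action_def vec_eq_iff)
  then show "g = h" using alcove_coord_inject by blast
qed

lemma alcove_eq_interior: "interior (convex hull {A, B, C}) = alcove"
proof -
  have "interior (convex hull {A, B, C}) =
      {v. \<exists>a b c. 0 < a \<and> 0 < b \<and> 0 < c \<and> a + b + c = 1 \<and> a *\<^sub>R A + b *\<^sub>R B + c *\<^sub>R C = v}"
    by (rule interior_convex_hull_3_minimal) (use equilateral_not_collinear[OF equilateral] in auto)
  also have "\<dots> = alcove"
  proof (intro subset_antisym subsetI)
    fix v assume "v \<in> {v. \<exists>a b c. 0 < a \<and> 0 < b \<and> 0 < c \<and> a + b + c = 1 \<and> a *\<^sub>R A + b *\<^sub>R B + c *\<^sub>R C = v}"
    then obtain a b c where "0 < a" "0 < b" "0 < c" "a + b + c = 1" "v = a *\<^sub>R A + b *\<^sub>R B + c *\<^sub>R C" by blast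
    with bary_combinations[OF equilateral this(4,5)] show "v \<in> alcove" by (simp add: alcove_def)
  next
    fix v assume "v \<in> alcove"
    then show "v \<in> {v. \<exists>a b c. 0 < a \<and> 0 < b \<and> 0 < c \<and> a + b + c = 1 \<and> a *\<^sub>R A + b *\<^sub>R B + c *\<^sub>R C = v}"
      using equilateral_decomposition(1)[OF equilateral, of v]
        equilateral_decomposition(2)[OF equilateral, of v, symmetric]
      unfolding alcove_def mem_Collect_eq by (intro exI conjI) auto
  qed
  finally show ?thesis .
qed

lemma nonempty_alcove: "alcove \<noteq> {}"
proof -
  have "(1/3) *\<^sub>R A + (1/3) *\<^sub>R B + (1/3) *\<^sub>R C \<in> alcove"
    using bary_combinations[OF equilateral _ refl, of "1/3" "1/3" "1/3"] by (simp add: alcove_def)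
  then show ?thesis by blast
qed

lemma frontier_alcove:
  assumes "x \<in> frontier alcove"
  shows "bary L A B C x = 0 \<or> bary L B C A x = 0 \<or> bary L C A B x = 0"
proof -
  have "open alcove" using alcove_eq_interior by (metis open_interior)
  then have "x \<in> closure alcove" "x \<notin> alcove" using assms by (auto simp: frontier_def interior_open)
  have "closed {x. 0 \<le> bary L A' B' C' x}" for A' B' C'
    unfolding bary_def by (intro closed_Collect_le continuous_intros)
  then have "closed ({x. 0 \<le> bary L A B C x} \<inter> {x. 0 \<le> bary L B C A x} \<inter> {x. 0 \<le> bary L C A B x})"
    by (intro closed_Int)
  then have "closure alcove \<subseteq> {x. 0 \<le> bary L A B C x} \<inter> {x. 0 \<le> bary L B C A x} \<inter> {x. 0 \<le> bary L C A B x}"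
    by (intro closure_minimal) (auto simp: alcove_def)
  with \<open>x \<in> closure alcove\<close> \<open>x \<notin> alcove\<close> show ?thesis by (auto simp: alcove_def)
qed

section \<open>The reflection group, its tiling and the parity of word length\<close>

lemma side_reflection_cases:
  assumes "\<rho> \<in> side_reflections A B C"
  obtains A' B' C' where "equilateral L A' B' C'" "\<rho> = reflection (affine hull {B', C'})"
  using assms equilateral equilateral_rotated unfolding side_reflections_def by blast

lemma side_reflection_involution: "\<rho> \<in> side_reflections A B C \<Longrightarrow> \<rho> (\<rho> x) = x"
  by (metis side_reflection_cases reflection_side_involution)

lemma side_reflection_isometry: "\<rho> \<in> side_reflections A B C \<Longrightarrow> dist (\<rho> x) (\<rho> y) = dist x y"
  by (metis side_reflection_cases reflection_side_isometry)

lemma frontier_side_reflection: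
  assumes "x \<in> frontier alcove"
  obtains \<rho> where "\<rho> \<in> side_reflections A B C" "\<rho> x = x"
  using frontier_alcove[OF assms] reflection_side_fixed[OF equilateral]
    reflection_side_fixed[OF equilateral_rotated(1)] reflection_side_fixed[OF equilateral_rotated(2)]
  unfolding side_reflections_def by (metis insertCI)

lemma reflection_group_isometry: "g \<in> reflection_group A B C \<Longrightarrow> dist (g x) (g y) = dist x y"
proof -
  have "dist (compose_word w x) (compose_word w y) = dist x y" if "w \<in> lists (side_reflections A B C)" for w
    using that by induction (simp_all add: compose_word_def side_reflection_isometry)
  then show "g \<in> reflection_group A B C \<Longrightarrow> dist (g x) (g y) = dist x y"
    unfolding reflection_group_def by blast
qed

lemma reflection_group_surj: "g \<in> reflection_group A B C \<Longrightarrow> surj g"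
proof -
  have "surj (compose_word w)" if "w \<in> lists (side_reflections A B C)" for w
    using that
  proof induction
    case (Cons \<rho> w)
    have "surj \<rho>" by (metis side_reflection_involution[OF Cons.hyps(1)] surjI)
    from comp_surj[OF Cons.IH this] show ?case by (simp add: compose_word_def)
  qed (simp add: compose_word_def)
  then show "g \<in> reflection_group A B C \<Longrightarrow> surj g" unfolding reflection_group_def by blast
qed

lemma reflection_group_action: "g \<in> reflection_group A B C \<Longrightarrow> \<exists>p k. alcove_action g p k"
  unfolding reflection_group_def using alcove_action_word by blast

lemma reflection_group_tiling:
  assumes "g \<in> reflection_group A B C" "h \<in> reflection_group A B C" "x \<in> alcove" "y \<in> alcove" "g x = h y"
  shows "g = h"
proof -
  obtain p k p' k' where "alcove_action g p k" "alcove_action h p' k'"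
    using reflection_group_action assms(1,2) by meson
  from alcove_action_unique(2)[OF this assms(3,4,5)] show ?thesis .
qed

text \<open>A shortest word and \<open>w\<close> spell the same map, hence have the same
  permutation, and its sign gives the parity of both lengths.\<close>

lemma reflection_length_parity:
  assumes "w \<in> lists (side_reflections A B C)"
  shows "(-1 :: real) ^ reflection_length A B C (compose_word w) = (-1) ^ length w"
proof -
  let ?P = "\<lambda>n. \<exists>v \<in> lists (side_reflections A B C). length v = n \<and> compose_word v = compose_word w"
  have "?P (reflection_length A B C (compose_word w))"
    unfolding reflection_length_def by (rule LeastI[of ?P "length w"]) (use assms in blast)
  then obtain v where v: "v \<in> lists (side_reflections A B C)" "compose_word v = compose_word w"
    "length v = reflection_length A B C (compose_word w)" by blast
  obtain p k p' k' where "alcove_action (compose_word v) p k" "sign p = (-1) ^ length v"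
    "alcove_action (compose_word w) p' k'" "sign p' = (-1) ^ length w"
    using alcove_action_word[OF assms] alcove_action_word[OF v(1)] by blast
  moreover obtain x where "x \<in> alcove" using nonempty_alcove by blast
  ultimately have "(-1 :: int) ^ length v = (-1) ^ length w"
    using alcove_action_unique(1)[of "compose_word v" p k "compose_word w" p' k' x x] v(2) by simp
  then show ?thesis unfolding v(3) by (simp add: minus_one_power_iff split: if_splits)
qed

lemma reflection_group_left_mult:
  assumes "\<rho> \<in> side_reflections A B C" "g \<in> reflection_group A B C"
  shows "\<rho> \<circ> g \<in> reflection_group A B C"
    and "(-1 :: real) ^ reflection_length A B C (\<rho> \<circ> g) = - ((-1) ^ reflection_length A B C g)"
proof -
  obtain w where w: "w \<in> lists (side_reflections A B C)" "g = compose_word w"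
    using assms(2) unfolding reflection_group_def by blast
  have c: "\<rho> \<circ> g = compose_word (\<rho> # w)" by (simp add: w compose_word_def)
  have l: "\<rho> # w \<in> lists (side_reflections A B C)" using w assms(1) by simp
  show "\<rho> \<circ> g \<in> reflection_group A B C" unfolding c reflection_group_def using l by blast
  show "(-1 :: real) ^ reflection_length A B C (\<rho> \<circ> g) = - ((-1) ^ reflection_length A B C g)"
    unfolding c reflection_length_parity[OF l] unfolding w(2) reflection_length_parity[OF w(1)] by simp
qed

lemma image_system_alcove:
  assumes R: "bij_betw R UNIV (reflection_group A B C)" "R 0 = id"
  shows "image_system alcove R (\<lambda>l. (-1) ^ reflection_length A B C (R l))"
proof
  show "open alcove" using alcove_eq_interior by (metis open_interior)
  show "bounded alcove"
    unfolding alcove_eq_interior[symmetric]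
    by (intro bounded_subset[OF compact_imp_bounded interior_subset] compact_convex_hull) simp
  show "alcove \<noteq> {}" by (rule nonempty_alcove)
  show "R 0 = id" by fact
  show "(-1 :: real) ^ reflection_length A B C (R 0) = 1"
    using reflection_length_parity[of "[]"] by (simp add: R(2) compose_word_def)
  have RW: "R l \<in> reflection_group A B C" for l using bij_betwE[OF R(1)] by simp
  fix l m x y
  show "\<bar>(-1 :: real) ^ reflection_length A B C (R l)\<bar> = 1" by (simp add: power_abs)
  show "dist (R l x) (R l y) = dist x y" by (rule reflection_group_isometry[OF RW])
  show "surj (R l)" by (rule reflection_group_surj[OF RW])
  show "R l x \<noteq> R m y" if "l \<noteq> m" "x \<in> alcove" "y \<in> alcove"
    using reflection_group_tiling[OF RW RW that(2,3)] that(1) bij_betw_imp_inj_on[OF R(1)] by (metis UNIV_I inj_onD)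
  show "\<exists>\<rho> \<pi>. bij \<pi> \<and> \<rho> x = x \<and> (\<forall>y z. dist (\<rho> y) (\<rho> z) = dist y z) \<and>
      (\<forall>l y. \<rho> (R l y) = R (\<pi> l) y) \<and>
      (\<forall>l. (-1 :: real) ^ reflection_length A B C (R (\<pi> l)) = - ((-1) ^ reflection_length A B C (R l)))"
    if x: "x \<in> frontier alcove"
  proof -
    obtain \<rho> where \<rho>: "\<rho> \<in> side_reflections A B C" "\<rho> x = x" by (rule frontier_side_reflection[OF x])
    \<comment> \<open>Left multiplication by \<rho>, carried over to indices through the enumeration
      \<open>R\<close>. It is an involution because \<rho> is one, hence bijective.\<close>
    define \<pi> where "\<pi> l = inv_into UNIV R (\<rho> \<circ> R l)" for l
    have R\<pi>: "R (\<pi> l) = \<rho> \<circ> R l" for l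
      unfolding \<pi>_def by (rule bij_betw_inv_into_right[OF R(1) reflection_group_left_mult(1)[OF \<rho>(1) RW]])
    have "R (\<pi> (\<pi> l)) = R l" for l
      by (simp add: R\<pi> fun_eq_iff side_reflection_involution[OF \<rho>(1)])
    then have "\<pi> (\<pi> l) = l" for l
      using bij_betw_imp_inj_on[OF R(1)] by (simp add: inj_eq)
    then have "bij \<pi>" by (intro o_bij[of \<pi>]) (auto simp: fun_eq_iff)
    then show ?thesis
      using \<rho> R\<pi> side_reflection_isometry[OF \<rho>(1)] reflection_group_left_mult(2)[OF \<rho>(1) RW] by (metis comp_apply)
  qed
qed

end

text \<open>Summability is asserted on its own because the infinite sum of a divergent series is an
  unspecified value.\<close>

theorem proposition4p5:
  fixes L :: real and A B C :: "real^2" and \<Delta> :: "(real^2) set"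
    and R :: "nat \<Rightarrow> real^2 \<Rightarrow> real^2" and s :: "nat \<Rightarrow> nat"
  assumes "L > 0"
    and "dist A B = L" and "dist B C = L" and "dist C A = L"
    and "\<Delta> = interior (convex hull {A, B, C})"
    and "bij_betw R UNIV (reflection_group A B C)" and "R 0 = id"
    and "\<And>l. s l = reflection_length A B C (R l)"
  shows "(\<forall>t>0. \<forall>x\<in>\<Delta>. \<forall>y\<in>\<Delta>. summable (\<lambda>l. (-1) ^ s l * gauss_kernel t x (R l y))) \<and>
    is_heat_kernel \<Delta> (\<lambda>t x y. \<Sum>l. (-1) ^ s l * gauss_kernel t x (R l y))"
proof -
  interpret equilateral_triangle L A B C
    using assms by unfold_locales (simp add: equilateral_def)
  have \<Delta>: "\<Delta> = alcove" using assms(5) alcove_eq_interior by simp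
  interpret image_system \<Delta> R "\<lambda>l. (-1) ^ s l"
    using image_system_alcove[OF assms(6,7)] unfolding \<Delta> assms(8) .
  have kernel: "image_kernel = (\<lambda>t x y. \<Sum>l. (-1) ^ s l * gauss_kernel t x (R l y))"
    unfolding image_kernel_def images_def gauss_kernel_diff[symmetric] ..
  have "summable (\<lambda>l. (-1) ^ s l * gauss_kernel t x (R l y))" if "t > 0" for t x y
    using summable_images[OF gaussian_decay_gauss_kernel that, of x y]
    unfolding gauss_kernel_diff[symmetric] .
  with is_heat_kernel_image_kernel show ?thesis unfolding kernel by blast
qed

end
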